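(* Let $\mathbb F/\mathbb E$ be a field extension of finite degree and let $\mathbf n=(n_1,\dots,n_\ell)$ be a partition of a positive integer $n$ into $\ell$ positive integers, i.e. $n=n_1+\dots+n_\ell$. The group of $\mathbb F$-linear isometries of the metric space $(\mathbb F^n,\mathrm d_{\mathrm{srk}}^{\mathbf n})$ is given by $$\big((\mathbb F^* )^{\ell}\times \mathrm{GL}(\mathbf n,\mathbb E)\big)\rtimes \mathcal S_{\lambda(\mathbf n)},$$ acting on $\mathbb F^n$ by $$(\mathbf a,M_1,\dots,M_\ell,\pi)\cdot(c^{(1)}\mid\dots\mid c^{(\ell)})=\big(a_1c^{(\pi^{-1}(1))}M_1\mid\dots\mid a_\ell c^{(\pi^{-1}(\ell))}M_\ell\big).$$ That is, an $\mathbb F$-linear map $f:\mathbb F^n\to\mathbb F^n$ is an isometry for $\mathrm d_{\mathrm{srk}}^{\mathbf n}$ if and only if there exist $\mathbf a=(a_1,\dots,a_\ell)\in(\mathbb F^* )^\ell$, $M_i\in\mathrm{GL}(n_i,\mathbb E)$ for $i=1,\dots,\ell$, and $\pi\in\mathcal S_{\lambda(\mathbf n)}$ such that $f$ is the map displayed above.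
   Context: Every $c\in\mathbb F^n$ is split into blocks $c=(c^{(1)}\mid\dots\mid c^{(\ell)})$ with $c^{(i)}\in\mathbb F^{n_i}$. The rank weight of $v=(v_1,\dots,v_N)\in\mathbb F^N$ is $\mathrm{wt}_{\mathrm{rk}}(v)=\dim_{\mathbb E}\langle v_1,\dots,v_N\rangle_{\mathbb E}$. The sum-rank weight is $\mathrm{wt}_{\mathrm{srk}}^{\mathbf n}(c)=\sum_{i=1}^{\ell}\mathrm{wt}_{\mathrm{rk}}(c^{(i)})$ and the sum-rank distance is $\mathrm d_{\mathrm{srk}}^{\mathbf n}(u,v)=\mathrm{wt}_{\mathrm{srk}}^{\mathbf n}(u-v)$. $\mathrm{GL}(\mathbf n,\mathbb E)=\mathrm{GL}(n_1,\mathbb E)\times\dots\times\mathrm{GL}(n_\ell,\mathbb E)$. The vector $\lambda(\mathbf n)=(\lambda_1,\dots,\lambda_t)$ lists the multiplicities of the $t$ distinct values occurring among $n_1,\dots,n_\ell$, and $\mathcal S_{\lambda(\mathbf n)}=\mathcal S_{\lambda_1}\times\dots\times\mathcal S_{\lambda_t}$ is regarded as the subgroup of the symmetric group on $\{1,\dots,\ell\}$ consisting of the permutations $\pi$ with $n_{\pi(i)}=n_i$ for all $i$. *)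

theory Defs
  imports
    "Jordan_Normal_Form.VS_Connect"
    "HOL-Algebra.Product_Groups"
    "HOL-Algebra.Group_Action"
    "HOL-Algebra.Sym_Groups"
begin

text \<open>A field extension F/E is a field homomorphism h from the field 'e to the field 'f.
  Through h, the field 'f is an 'e-vector space, and the map h identifies E with a subfield of F.\<close>

definition ext_scale :: "('e::field \<Rightarrow> 'f::field) \<Rightarrow> 'e \<Rightarrow> 'f \<Rightarrow> 'f" where
  "ext_scale h a x = h a * x"

definition finite_extension :: "('e::field \<Rightarrow> 'f::field) \<Rightarrow> bool" where
  "finite_extension h \<longleftrightarrow>
     field_hom h \<and> (\<exists>B. finite_dimensional_vector_space (ext_scale h) B)"

text \<open>A partition of n is given by its length l and its parts ns 1, ..., ns l.  The blocks of a
  vector are therefore numbered from 1 to l, whereas the coordinates of a vector start at 0.\<close>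

definition vec_block :: "(nat \<Rightarrow> nat) \<Rightarrow> nat \<Rightarrow> 'f vec \<Rightarrow> 'f vec" where
  "vec_block ns i c = vec (ns i) (\<lambda>j. c $ ((\<Sum>k\<in>{1..<i}. ns k) + j))"

definition vec_concat :: "nat \<Rightarrow> (nat \<Rightarrow> 'f vec) \<Rightarrow> 'f vec" where
  "vec_concat l b = foldr (@\<^sub>v) (map b [1..<Suc l]) vNil"

definition rk_weight :: "('e::field \<Rightarrow> 'f::field) \<Rightarrow> 'f vec \<Rightarrow> nat" where
  "rk_weight h v =
     vector_space.dim (ext_scale h) (Modules.module.span (ext_scale h) (set\<^sub>v v))"

definition srk_weight ::
  "('e::field \<Rightarrow> 'f::field) \<Rightarrow> nat \<Rightarrow> (nat \<Rightarrow> nat) \<Rightarrow> 'f vec \<Rightarrow> nat" where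
  "srk_weight h l ns c = (\<Sum>i=1..l. rk_weight h (vec_block ns i c))"

definition srk_dist ::
  "('e::field \<Rightarrow> 'f::field) \<Rightarrow> nat \<Rightarrow> (nat \<Rightarrow> nat) \<Rightarrow> 'f vec \<Rightarrow> 'f vec \<Rightarrow> nat" where
  "srk_dist h l ns u v = srk_weight h l ns (u - v)"

text \<open>Neither of the next two notions constrains f outside of the space of vectors of length n.\<close>

definition vec_linear :: "nat \<Rightarrow> ('f::field vec \<Rightarrow> 'f vec) \<Rightarrow> bool" where
  "vec_linear n f \<longleftrightarrow>
     linear_map class_ring (module_vec TYPE('f) n) (module_vec TYPE('f) n) f"

definition srk_isometry ::
  "('e::field \<Rightarrow> 'f::field) \<Rightarrow> nat \<Rightarrow> (nat \<Rightarrow> nat) \<Rightarrow> nat \<Rightarrow> ('f vec \<Rightarrow> 'f vec) \<Rightarrow> bool" where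
  "srk_isometry h l ns n f \<longleftrightarrow>
     (\<forall>u\<in>carrier_vec n. \<forall>v\<in>carrier_vec n. srk_dist h l ns (f u) (f v) = srk_dist h l ns u v)"

definition linear_isometries ::
  "('e::field \<Rightarrow> 'f::field) \<Rightarrow> nat \<Rightarrow> (nat \<Rightarrow> nat) \<Rightarrow> nat \<Rightarrow> ('f vec \<Rightarrow> 'f vec) set" where
  "linear_isometries h l ns n =
     {f \<in> Bij (carrier_vec n). vec_linear n f \<and> srk_isometry h l ns n f}"

abbreviation field_units :: "'f::field itself \<Rightarrow> 'f monoid" where
  "field_units _ \<equiv> units_of (class_ring :: 'f ring)"

abbreviation GL :: "'e::field itself \<Rightarrow> nat \<Rightarrow> 'e mat monoid" where
  "GL ty k \<equiv> units_of (ring_mat ty k ())"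

definition part_perms :: "nat \<Rightarrow> (nat \<Rightarrow> nat) \<Rightarrow> (nat \<Rightarrow> nat) monoid" where
  "part_perms l ns =
     (sym_group l)\<lparr>carrier := {\<pi> \<in> carrier (sym_group l). \<forall>i\<in>{1..l}. ns (\<pi> i) = ns i}\<rparr>"

definition opposite_group :: "'a monoid \<Rightarrow> 'a monoid" where
  "opposite_group G = G\<lparr>monoid.mult := (\<lambda>x y. y \<otimes>\<^bsub>G\<^esub> x)\<rparr>"

text \<open>Meaningful only when \<theta> is a homomorphism from H to the automorphisms of N.\<close>

definition semidirect_product ::
  "'a monoid \<Rightarrow> 'b monoid \<Rightarrow> ('b \<Rightarrow> 'a \<Rightarrow> 'a) \<Rightarrow> ('a \<times> 'b) monoid" where
  "semidirect_product N H \<theta> =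
     \<lparr>carrier = carrier N \<times> carrier H,
      monoid.mult = (\<lambda>(x, p) (y, q). (x \<otimes>\<^bsub>N\<^esub> \<theta> p y, p \<otimes>\<^bsub>H\<^esub> q)),
      one = (\<one>\<^bsub>N\<^esub>, \<one>\<^bsub>H\<^esub>)\<rparr>"

text \<open>Matrices multiply row vectors from the right, so letting first M' and then M act on a row
  vector amounts to multiplying it by M' M.  For srk_action to be a left action, the
  general linear groups must therefore carry the opposite multiplication (as abstract groups they
  are unchanged, being isomorphic to their opposites).\<close>

definition scalar_matrix_group ::
  "'e::field itself \<Rightarrow> 'f::field itself \<Rightarrow> nat \<Rightarrow> (nat \<Rightarrow> nat)
     \<Rightarrow> ((nat \<Rightarrow> 'f) \<times> (nat \<Rightarrow> 'e mat)) monoid" where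
  "scalar_matrix_group E F l ns =
     product_group {1..l} (\<lambda>i. field_units F) \<times>\<times>
     product_group {1..l} (\<lambda>i. opposite_group (GL E (ns i)))"

definition permute_components ::
  "nat \<Rightarrow> (nat \<Rightarrow> nat) \<Rightarrow> (nat \<Rightarrow> 'a) \<times> (nat \<Rightarrow> 'b) \<Rightarrow> (nat \<Rightarrow> 'a) \<times> (nat \<Rightarrow> 'b)" where
  "permute_components l \<pi> = (\<lambda>(a, M).
     (\<lambda>i\<in>{1..l}. a (inv_into UNIV \<pi> i), \<lambda>i\<in>{1..l}. M (inv_into UNIV \<pi> i)))"

definition srk_group ::
  "'e::field itself \<Rightarrow> 'f::field itself \<Rightarrow> nat \<Rightarrow> (nat \<Rightarrow> nat)
     \<Rightarrow> (((nat \<Rightarrow> 'f) \<times> (nat \<Rightarrow> 'e mat)) \<times> (nat \<Rightarrow> nat)) monoid" where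
  "srk_group E F l ns =
     semidirect_product (scalar_matrix_group E F l ns) (part_perms l ns) (permute_components l)"

definition row_mult :: "'f::field vec \<Rightarrow> 'f mat \<Rightarrow> 'f vec" where
  "row_mult v A = transpose_mat A *\<^sub>v v"

definition srk_map ::
  "('e::field \<Rightarrow> 'f::field) \<Rightarrow> nat \<Rightarrow> (nat \<Rightarrow> nat)
     \<Rightarrow> (nat \<Rightarrow> 'f) \<Rightarrow> (nat \<Rightarrow> 'e mat) \<Rightarrow> (nat \<Rightarrow> nat) \<Rightarrow> 'f vec \<Rightarrow> 'f vec" where
  "srk_map h l ns a M \<pi> c =
     vec_concat l (\<lambda>i. a i \<cdot>\<^sub>v row_mult (vec_block ns (inv_into UNIV \<pi> i) c) (map_mat h (M i)))"

definition srk_action ::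
  "('e::field \<Rightarrow> 'f::field) \<Rightarrow> nat \<Rightarrow> (nat \<Rightarrow> nat) \<Rightarrow> nat
     \<Rightarrow> ((nat \<Rightarrow> 'f) \<times> (nat \<Rightarrow> 'e mat)) \<times> (nat \<Rightarrow> nat) \<Rightarrow> 'f vec \<Rightarrow> 'f vec" where
  "srk_action h l ns n = (\<lambda>((a, M), \<pi>). \<lambda>c\<in>carrier_vec n. srk_map h l ns a M \<pi> c)"

end

theory Submission
  imports Defs
begin

text \<open>A linear isometry preserves weight 1, so it maps each \<open>v \<noteq> 0\<close> over E, placed in block i, to a vector
  \<open>a w\<close> in a single block p, with \<open>a \<in> F\<^sup>*\<close> and w over E.  Since sums of unit vectors of block i
  also have weight 1, neither p nor the class of a modulo \<open>E\<^sup>*\<close> depends on the unit vector,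
  so f acts on block i as \<open>v \<mapsto> a (v W)\<close> for a matrix W over E, which injectivity makes of full rank.
  If two blocks i, k were mapped to the same block, the weight 2 vector
  \<open>u / a\<^sub>i + v / a\<^sub>k\<close> with u, v over E would have an image of weight at most 1.  Hence p
  is a permutation of the blocks with \<open>n\<^sub>i \<le> n\<^bsub>p(i)\<^esub>\<close>; summing over i yields equality.\<close>

section \<open>Blocks\<close>

text \<open>Weight 1 of \<open>a w + b w'\<close>, with w and w' over E, does not by itself make a
  and b proportional over E: if w and w' are proportional, the sum has weight at most 1 whatever a
  and b are. Linearity over the large field excludes this case. The images of the two unit vectors
  would then be dependent over F, so a nonzero combination of the unit vectors would be mapped to 0,
  although only 0 has weight 0.

  A priori p is just a map between blocks of possibly different lengths, so the matrices start out
  rectangular and are seen to be square only after the lengths have been compared.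

  The parameters of an isometry are in general not unique: for nonzero t in E, the scalar
  \<open>h t\<close> and the matrix given by the inverse of t times the identity cancel in the same
  block. This is why the isometries are described as the image of an action, and not as an
  isomorphic copy of the group of parameters.\<close>

lemma foldr_append_vec: "foldr (@\<^sub>v) vs w = foldr (@\<^sub>v) vs vNil @\<^sub>v w"
proof (induction vs)
  case (Cons v vs)
  have "v @\<^sub>v (x @\<^sub>v w) = (v @\<^sub>v x) @\<^sub>v w" for x
    by (intro eq_vecI) auto
  then show ?case
    using Cons.IH by simp
qed simp

lemma vec_concat_0 [simp]: "vec_concat 0 b = vNil"
  by (simp add: vec_concat_def)

text \<open>The fold nests to the right and therefore peels off the first block. Associativity turns
  this into a recursion at the last block, so that inductions on \<open>l\<close> follow the
  numbering of the blocks.\<close>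

lemma vec_concat_Suc: "vec_concat (Suc l) b = vec_concat l b @\<^sub>v b (Suc l)"
proof -
  have "b (Suc l) @\<^sub>v vNil = b (Suc l)"
    by auto
  then show ?thesis
    using foldr_append_vec[of "map b [1..<Suc l]" "b (Suc l)"]
    by (simp add: vec_concat_def)
qed

lemma dim_vec_concat [simp]: "dim_vec (vec_concat l b) = (\<Sum>i=1..l. dim_vec (b i))"
  by (induction l) (simp_all add: vec_concat_Suc)

lemma vec_concat_cong: "(\<And>i. i \<in> {1..l} \<Longrightarrow> b i = b' i) \<Longrightarrow> vec_concat l b = vec_concat l b'"
  by (induction l) (simp_all add: vec_concat_Suc)

text \<open>This bound keeps the entries of block i inside a vector of full length; componentwise
  laws such as those for addition hold only at indices within range.\<close>

lemma offset_le:
  fixes i l :: nat and ns :: "nat \<Rightarrow> nat"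
  assumes "i \<in> {1..l}"
  shows "(\<Sum>k\<in>{1..<i}. ns k) + ns i \<le> (\<Sum>k=1..l. ns k)"
proof -
  from assms have "(\<Sum>k\<in>{1..<i}. ns k) + ns i = sum ns (insert i {1..<i})"
    by simp
  also have "\<dots> \<le> (\<Sum>k=1..l. ns k)"
    using assms by (intro sum_mono2) auto
  finally show ?thesis .
qed

lemma vec_block_carrier [simp]: "vec_block ns i c \<in> carrier_vec (ns i)"
  by (simp add: vec_block_def)

lemma vec_block_vec_concat:
  assumes "\<And>i. i \<in> {1..l} \<Longrightarrow> b i \<in> carrier_vec (ns i)" and "i \<in> {1..l}"
  shows "vec_block ns i (vec_concat l b) = b i"
  using assms
proof (induction l)
  case (Suc l)
  have dim: "dim_vec (vec_concat l b) = (\<Sum>k=1..l. ns k)"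
    using Suc.prems(1) by (auto intro!: sum.cong)
  have dim_Suc: "dim_vec (b (Suc l)) = ns (Suc l)"
    using Suc.prems(1)[of "Suc l"] by auto
  show ?case
  proof (cases "i = Suc l")
    case True
    show ?thesis
      unfolding True vec_concat_Suc
      using dim dim_Suc by (auto simp: vec_block_def atLeastLessThanSuc_atLeastAtMost)
  next
    case False
    then have i: "i \<in> {1..l}"
      using Suc.prems(2) by auto
    have "vec_block ns i (vec_concat (Suc l) b) = vec_block ns i (vec_concat l b)"
      using offset_le[OF i, of ns] dim dim_Suc by (auto simp: vec_block_def vec_concat_Suc)
    also have "\<dots> = b i"
      using Suc.IH Suc.prems(1) i by simp
    finally show ?thesis .
  qed
qed simp

lemma index_in_block:
  fixes k l :: nat and ns :: "nat \<Rightarrow> nat"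
  assumes "k < (\<Sum>i=1..l. ns i)"
  shows "\<exists>i j. i \<in> {1..l} \<and> j < ns i \<and> k = (\<Sum>m\<in>{1..<i}. ns m) + j"
  using assms
proof (induction l )
  case 0
  then show ?case by simp
next
  case (Suc l)
  show ?case
  proof (cases "k < (\<Sum>i=1..l. ns i)")
    case True
    then show ?thesis
      using Suc.IH by fastforce
  next
    case False
    then show ?thesis
      using Suc.prems by (intro exI[of _ "Suc l"] exI[of _ "k - (\<Sum>i=1..l. ns i)"])
        (auto simp: atLeastLessThanSuc_atLeastAtMost)
  qed
qed

lemma vec_eq_blockwise:
  assumes "u \<in> carrier_vec (\<Sum>i=1..l. ns i)" and "v \<in> carrier_vec (\<Sum>i=1..l. ns i)"
    and eq: "\<And>i. i \<in> {1..l} \<Longrightarrow> vec_block ns i u = vec_block ns i v"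
  shows "u = v"
proof (rule eq_vecI)
  fix k assume "k < dim_vec v"
  then obtain i j where ij: "i \<in> {1..l}" "j < ns i" "k = (\<Sum>m\<in>{1..<i}. ns m) + j"
    using assms(2) index_in_block[of k ns l] by auto
  have "vec_block ns i u $ j = vec_block ns i v $ j"
    by (simp only: eq[OF ij(1)])
  then show "u $ k = v $ k"
    using ij by (simp add: vec_block_def)
qed (use assms in auto)

lemma vec_block_add:
  assumes "u \<in> carrier_vec (\<Sum>i=1..l. ns i)" "v \<in> carrier_vec (\<Sum>i=1..l. ns i)" "i \<in> {1..l}"
  shows "vec_block ns i (u + v) = vec_block ns i u + vec_block ns i v"
  using assms offset_le[of i l ns] by (auto simp: vec_block_def)

lemma vec_block_smult:
  assumes "u \<in> carrier_vec (\<Sum>i=1..l. ns i)" "i \<in> {1..l}"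
  shows "vec_block ns i (a \<cdot>\<^sub>v u) = a \<cdot>\<^sub>v vec_block ns i u"
  using assms offset_le[of i l ns] by (auto simp: vec_block_def)

lemma vec_block_zero:
  assumes "i \<in> {1..l}"
  shows "vec_block ns i (0\<^sub>v (\<Sum>i=1..l. ns i)) = 0\<^sub>v (ns i)"
  using assms offset_le[of i l ns] by (auto simp: vec_block_def)

section \<open>Linear maps on coordinate vectors\<close>

lemma vec_linearI:
  fixes f :: "'f::field vec \<Rightarrow> 'f vec"
  assumes "\<And>u. u \<in> carrier_vec n \<Longrightarrow> f u \<in> carrier_vec n"
    and "\<And>u v. u \<in> carrier_vec n \<Longrightarrow> v \<in> carrier_vec n \<Longrightarrow> f (u + v) = f u + f v"
    and "\<And>a u. u \<in> carrier_vec n \<Longrightarrow> f (a \<cdot>\<^sub>v u) = a \<cdot>\<^sub>v f u"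
  shows "vec_linear n f"
proof -
  interpret vectorspace class_ring "module_vec TYPE('f) n"
    by (rule vec_vs)
  show ?thesis
    unfolding vec_linear_def
    by unfold_locales (use assms in \<open>auto simp: module_vec_simps module_hom_def LinearCombinations.module_hom_def\<close>)
qed

lemma vec_linearD:
  fixes f :: "'f::field vec \<Rightarrow> 'f vec"
  assumes "vec_linear n f"
  shows "u \<in> carrier_vec n \<Longrightarrow> f u \<in> carrier_vec n"
    and "u \<in> carrier_vec n \<Longrightarrow> v \<in> carrier_vec n \<Longrightarrow> f (u + v) = f u + f v"
    and "u \<in> carrier_vec n \<Longrightarrow> f (a \<cdot>\<^sub>v u) = a \<cdot>\<^sub>v f u"
proof -
  interpret linear_map class_ring "module_vec TYPE('f) n" "module_vec TYPE('f) n" f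
    using assms by (simp add: vec_linear_def)
  show "u \<in> carrier_vec n \<Longrightarrow> f u \<in> carrier_vec n"
    and "u \<in> carrier_vec n \<Longrightarrow> v \<in> carrier_vec n \<Longrightarrow> f (u + v) = f u + f v"
    and "u \<in> carrier_vec n \<Longrightarrow> f (a \<cdot>\<^sub>v u) = a \<cdot>\<^sub>v f u"
    using f_hom by (auto simp: module_vec_simps module_hom_def LinearCombinations.module_hom_def class_field_def)
qed

lemma vec_linear_minus:
  assumes "vec_linear n f" "u \<in> carrier_vec n" "v \<in> carrier_vec n"
  shows "f (u - v) = f u - f v"
proof -
  have "u - v = u + (- 1) \<cdot>\<^sub>v v"
    using assms by (auto simp: vec_eq_iff)
  moreover have "f u - f v = f u + (- 1) \<cdot>\<^sub>v f v"
    using assms vec_linearD(1)[OF assms(1)] by (auto simp: vec_eq_iff)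
  ultimately show ?thesis
    using assms vec_linearD by (metis smult_carrier_vec)
qed

text \<open>Stated without \<^const>\<open>vec_linear\<close>, which is limited to endomorphisms.\<close>

lemma linear_eq_on_unit_vecs:
  fixes f g :: "'f::field vec \<Rightarrow> 'f vec"
  assumes f: "\<And>u. u \<in> carrier_vec n \<Longrightarrow> f u \<in> carrier_vec m"
      "\<And>u v. u \<in> carrier_vec n \<Longrightarrow> v \<in> carrier_vec n \<Longrightarrow> f (u + v) = f u + f v"
      "\<And>a u. u \<in> carrier_vec n \<Longrightarrow> f (a \<cdot>\<^sub>v u) = a \<cdot>\<^sub>v f u"
    and g: "\<And>u. u \<in> carrier_vec n \<Longrightarrow> g u \<in> carrier_vec m"
      "\<And>u v. u \<in> carrier_vec n \<Longrightarrow> v \<in> carrier_vec n \<Longrightarrow> g (u + v) = g u + g v"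
      "\<And>a u. u \<in> carrier_vec n \<Longrightarrow> g (a \<cdot>\<^sub>v u) = a \<cdot>\<^sub>v g u"
    and unit: "\<And>k. k < n \<Longrightarrow> f (unit_vec n k) = g (unit_vec n k)"
    and c: "c \<in> carrier_vec n"
  shows "f c = g c"
proof -
  \<comment> \<open>The number r bounds the support of c. Each induction step clears coordinate r -
    1, and r = n covers all vectors. In the base case c is zero, and homogeneity applies once it is
    written as 0 times itself.\<close>
  have "f c = g c" if "r \<le> n" "c \<in> carrier_vec n" "\<And>k. r \<le> k \<Longrightarrow> k < n \<Longrightarrow> c $ k = 0" for r c
    using that
  proof (induction r arbitrary: c)
    case 0
    then have "c = 0 \<cdot>\<^sub>v c"
      by (auto simp: vec_eq_iff)
    moreover have "0 \<cdot>\<^sub>v f c = 0 \<cdot>\<^sub>v g c"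
      using f(1)[OF 0(2)] g(1)[OF 0(2)] by auto
    ultimately show ?case
      using f(3)[OF 0(2), of 0] g(3)[OF 0(2), of 0] by simp
  next
    case (Suc r)
    define c' where "c' = vec n (\<lambda>k. if k = r then 0 else c $ k)"
    have c': "c' \<in> carrier_vec n"
      by (simp add: c'_def)
    have "f c' = g c'"
      using Suc.prems by (intro Suc.IH) (auto simp: c'_def)
    moreover have "f (unit_vec n r) = g (unit_vec n r)"
      using Suc.prems unit by simp
    moreover have "c = c' + c $ r \<cdot>\<^sub>v unit_vec n r"
      using Suc.prems by (auto simp: c'_def vec_eq_iff)
    from this have split: "k c = k c' + c $ r \<cdot>\<^sub>v k (unit_vec n r)"
      if "\<And>u v. u \<in> carrier_vec n \<Longrightarrow> v \<in> carrier_vec n \<Longrightarrow> k (u + v) = k u + k v"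
        "\<And>a u. u \<in> carrier_vec n \<Longrightarrow> k (a \<cdot>\<^sub>v u) = a \<cdot>\<^sub>v k u" for k :: "'f vec \<Rightarrow> 'f vec"
      using that(1)[of c' "c $ r \<cdot>\<^sub>v unit_vec n r"] that(2)[of "unit_vec n r" "c $ r"] c' by simp
    ultimately show ?case
      using split[of f, OF f(2,3)] split[of g, OF g(2,3)] by simp
  qed
  from this[of n] c show ?thesis by simp
qed

section \<open>Rank weight and the maps of the group\<close>

text \<open>\<open>finite_extension\<close> only asserts that a basis exists. Fixing one as
  \<open>B\<close> makes F a finite-dimensional space over E, which gives access to monotonicity of
  dimension and to the criterion that a subspace of full dimension is the whole space.\<close>

locale finite_degree_ext = field_hom h for h :: "'e::field \<Rightarrow> 'f::field" +
  fixes B :: "'f set"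
  assumes finite_dimensional: "finite_dimensional_vector_space (ext_scale h) B"
begin

sublocale vs: finite_dimensional_vector_space "ext_scale h" B
  by (rule finite_dimensional)

lemma rk_weight_eq_dim: "rk_weight h v = vs.dim (set\<^sub>v v)"
  by (simp add: rk_weight_def)

lemma rk_weight_eq_0_iff:
  assumes "v \<in> carrier_vec m"
  shows "rk_weight h v = 0 \<longleftrightarrow> v = 0\<^sub>v m"
proof -
  have "rk_weight h v = 0 \<longleftrightarrow> (\<forall>k<dim_vec v. v $ k = 0)"
    by (simp add: rk_weight_eq_dim vec_set_def image_subset_iff Ball_def)
  also have "\<dots> \<longleftrightarrow> v = 0\<^sub>v m"
    using assms by (auto simp: vec_eq_iff)
  finally show ?thesis .
qed

text \<open>Multiplication by a nonzero element of F is an injective E-linear map of F, so it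
  preserves the dimension spanned by the entries.\<close>

lemma rk_weight_smult:
  assumes "a \<noteq> 0"
  shows "rk_weight h (a \<cdot>\<^sub>v v) = rk_weight h v"
proof -
  interpret finite_dimensional_vector_space_pair "ext_scale h" B "ext_scale h" B ..
  have "Vector_Spaces.linear (ext_scale h) (ext_scale h) ((*) a)"
    by unfold_locales (simp_all add: ext_scale_def algebra_simps)
  moreover have "inj_on ((*) a) (vs.span (set\<^sub>v v))"
    using assms by (auto simp: inj_on_def)
  ultimately have "vs.dim ((*) a ` set\<^sub>v v) = vs.dim (set\<^sub>v v)"
    by (rule dim_image_eq)
  moreover have "set\<^sub>v (a \<cdot>\<^sub>v v) = (*) a ` set\<^sub>v v"
    by (auto simp: vec_set_def)
  ultimately show ?thesis
    by (simp add: rk_weight_eq_dim)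
qed

text \<open>The matrix has entries in E, so every entry of the product is an E-linear combination of
  the entries of v.\<close>

lemma rk_weight_row_mult_le:
  assumes A: "A \<in> carrier_mat (dim_vec v) m"
  shows "rk_weight h (row_mult v (map_mat h A)) \<le> rk_weight h v"
  unfolding rk_weight_eq_dim
proof (rule vs.dim_mono, rule subsetI)
  fix x assume "x \<in> set\<^sub>v (row_mult v (map_mat h A))"
  then obtain k where "k < m" and x: "x = row_mult v (map_mat h A) $ k"
    using A by (auto simp: vec_set_def row_mult_def)
  then have "x = (\<Sum>j<dim_vec v. ext_scale h (A $$ (j, k)) (v $ j))"
    using A by (simp add: row_mult_def scalar_prod_def ext_scale_def lessThan_atLeast0)
  also have "\<dots> \<in> vs.span (set\<^sub>v v)"
    by (intro vs.span_sum vs.span_scale vs.span_base) (auto simp: vec_set_def)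
  finally show "x \<in> vs.span (set\<^sub>v v)" .
qed

text \<open>All entries lie on the E-line through a.\<close>

lemma rk_weight_smult_hom_le: "rk_weight h (a \<cdot>\<^sub>v map_vec h w) \<le> 1"
proof -
  have "x \<in> vs.span {a}" if "x \<in> set\<^sub>v (a \<cdot>\<^sub>v map_vec h w)" for x
  proof -
    from that obtain k where "k < dim_vec w" "x = a * h (w $ k)"
      by (auto simp: vec_set_def simp del: mult_cancel_left)
    then have "x = ext_scale h (w $ k) a"
      by (simp add: ext_scale_def mult.commute)
    then show ?thesis
      by (simp add: vs.span_base vs.span_scale)
  qed
  then have "rk_weight h (a \<cdot>\<^sub>v map_vec h w) \<le> vs.dim {a}"
    unfolding rk_weight_eq_dim by (intro vs.dim_mono) blast
  also have "\<dots> \<le> 1"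
    by simp
  finally show ?thesis .
qed

text \<open>The entries span an E-line, and any nonzero entry already spans it. Taking such an entry
  as the scalar a leaves quotients in E, and the quotient at its own position is nonzero.\<close>

lemma rk_weight_eq_1E:
  assumes "rk_weight h v = 1"
  obtains a w where "a \<noteq> 0" "w \<in> carrier_vec (dim_vec v)" "w \<noteq> 0\<^sub>v (dim_vec v)" "v = a \<cdot>\<^sub>v map_vec h w"
proof -
  have "v \<noteq> 0\<^sub>v (dim_vec v)"
    using rk_weight_eq_0_iff[OF carrier_vecI[OF refl], of v] assms by simp
  then obtain k where k: "k < dim_vec v" "v $ k \<noteq> 0"
    by (auto simp: vec_eq_iff)
  have "vs.dim {v $ k} = vs.dim (vs.span (set\<^sub>v v))"
    using assms k by (simp add: rk_weight_eq_dim)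
  moreover have "vs.span {v $ k} \<subseteq> vs.span (vs.span (set\<^sub>v v))"
    using k by (intro vs.span_mono) (auto simp: vec_set_def vs.span_base)
  ultimately have span: "vs.span {v $ k} = vs.span (set\<^sub>v v)"
    using vs.dim_eq_span[of "{v $ k}" "vs.span (set\<^sub>v v)"] k
    by (auto simp: vec_set_def vs.span_base vs.span_span)
  have "\<exists>c. v $ j = h c * v $ k" if "j < dim_vec v" for j
  proof -
    have "v $ j \<in> vs.span {v $ k}"
      unfolding span using that by (auto simp: vec_set_def vs.span_base)
    then show ?thesis
      by (auto simp: vs.span_singleton ext_scale_def)
  qed
  then obtain c where c: "\<And>j. j < dim_vec v \<Longrightarrow> v $ j = h (c j) * v $ k"
    by metis
  show thesis
  proof (rule that)
    show "v $ k \<noteq> 0" by fact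
    show "v = v $ k \<cdot>\<^sub>v map_vec h (vec (dim_vec v) c)"
      by (rule eq_vecI) (simp_all add: c mult.commute)
    have "h (c k) \<noteq> 0"
      using c[OF k(1)] k(2) by auto
    then have "c k \<noteq> 0"
      by auto
    then show "vec (dim_vec v) c \<noteq> 0\<^sub>v (dim_vec v)"
      using k(1) by (auto simp: vec_eq_iff)
  qed simp
qed

end

section \<open>Row vectors and invertible matrices\<close>

lemma GL_carrierD:
  assumes "A \<in> carrier (GL TYPE('e::field) k)"
  shows "A \<in> carrier_mat k k"
  using assms by (simp add: units_of_carrier Units_def ring_mat_def)

lemma GL_inverseE:
  assumes "A \<in> carrier (GL TYPE('e::field) k)"
  obtains A' where "A' \<in> carrier (GL TYPE('e) k)" "A * A' = 1\<^sub>m k" "A' * A = 1\<^sub>m k"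
proof -
  from assms obtain A' where "A \<in> carrier_mat k k" "A' \<in> carrier_mat k k" "A * A' = 1\<^sub>m k" "A' * A = 1\<^sub>m k"
    by (auto simp: units_of_carrier Units_def ring_mat_simps)
  moreover from this have "A' \<in> carrier (GL TYPE('e) k)"
    unfolding units_of_carrier Units_def ring_mat_simps by blast
  ultimately show thesis
    using that by blast
qed

lemma row_mult_carrier [simp]: "A \<in> carrier_mat k m \<Longrightarrow> row_mult v A \<in> carrier_vec m"
  by (rule carrier_vecI) (simp add: row_mult_def)

lemma row_mult_row_mult:
  assumes "v \<in> carrier_vec k" "A \<in> carrier_mat k m" "A' \<in> carrier_mat m p"
  shows "row_mult (row_mult v A) A' = row_mult v (A * A')"
  using assms by (simp add: row_mult_def transpose_mult)

lemma row_mult_one [simp]: "v \<in> carrier_vec k \<Longrightarrow> row_mult v (1\<^sub>m k) = v"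
  by (simp add: row_mult_def)

lemma row_mult_add:
  assumes "u \<in> carrier_vec k" "v \<in> carrier_vec k" "A \<in> carrier_mat k m"
  shows "row_mult (u + v) A = row_mult u A + row_mult v A"
  using assms unfolding row_mult_def by (intro mult_add_distrib_mat_vec[where nr = m and nc = k]) simp_all

lemma row_mult_smult:
  assumes "v \<in> carrier_vec k" "A \<in> carrier_mat k m"
  shows "row_mult (a \<cdot>\<^sub>v v) A = a \<cdot>\<^sub>v row_mult v A"
  using assms unfolding row_mult_def by (intro mult_mat_vec[where nr = m and nc = k]) simp_all

lemma row_mult_zero: "A \<in> carrier_mat k m \<Longrightarrow> row_mult (0\<^sub>v k) A = 0\<^sub>v m"
  by (rule eq_vecI) (simp_all add: row_mult_def)

lemma row_mult_unit_vec:
  assumes "A \<in> carrier_mat k m" "j < k"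
  shows "row_mult (unit_vec k j) A = row A j"
  using assms by (intro eq_vecI) (simp_all add: row_mult_def)

text \<open>Neither A nor its inverse can raise the weight, hence both preserve it.\<close>

lemma (in finite_degree_ext) rk_weight_row_mult:
  assumes A: "A \<in> carrier (GL TYPE('e) k)" and v: "v \<in> carrier_vec k"
  shows "rk_weight h (row_mult v (map_mat h A)) = rk_weight h v"
proof (rule antisym)
  show "rk_weight h (row_mult v (map_mat h A)) \<le> rk_weight h v"
    using GL_carrierD[OF A] v by (intro rk_weight_row_mult_le) auto
  obtain A' where A': "A' \<in> carrier (GL TYPE('e) k)" and inv: "A * A' = 1\<^sub>m k"
    using A by (rule GL_inverseE)
  have "rk_weight h (row_mult (row_mult v (map_mat h A)) (map_mat h A'))
      \<le> rk_weight h (row_mult v (map_mat h A))"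
    using GL_carrierD[OF A] GL_carrierD[OF A'] by (intro rk_weight_row_mult_le) (auto simp: row_mult_def)
  also have "row_mult (row_mult v (map_mat h A)) (map_mat h A') = row_mult v (map_mat h (A * A'))"
    using GL_carrierD[OF A] GL_carrierD[OF A'] v
    by (simp add: row_mult_row_mult[where k = k and m = k and p = k] mat_hom_mult[where n = k and nr = k and nc = k])
  also have "\<dots> = v"
    using v by (simp add: inv mat_hom_one)
  finally show "rk_weight h v \<le> rk_weight h (row_mult v (map_mat h A))" .
qed

section \<open>Admissible parameters and the maps they define\<close>

lemma part_permsD:
  assumes "\<pi> \<in> carrier (part_perms l ns)"
  shows "\<pi> permutes {1..l}"
    and "i \<in> {1..l} \<Longrightarrow> \<pi> i \<in> {1..l}"
    and "i \<in> {1..l} \<Longrightarrow> inv_into UNIV \<pi> i \<in> {1..l}"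
    and "i \<in> {1..l} \<Longrightarrow> ns (\<pi> i) = ns i"
    and "i \<in> {1..l} \<Longrightarrow> ns (inv_into UNIV \<pi> i) = ns i"
    and "\<pi> (inv_into UNIV \<pi> i) = i"
    and "inv_into UNIV \<pi> (\<pi> i) = i"
proof -
  show \<pi>: "\<pi> permutes {1..l}"
    using assms by (simp add: part_perms_def sym_group_carrier)
  show "i \<in> {1..l} \<Longrightarrow> \<pi> i \<in> {1..l}" for i
    using permutes_in_image[OF \<pi>] by simp
  show inv: "i \<in> {1..l} \<Longrightarrow> inv_into UNIV \<pi> i \<in> {1..l}" for i
    using permutes_in_image[OF permutes_inv[OF \<pi>]] by simp
  show ns: "i \<in> {1..l} \<Longrightarrow> ns (\<pi> i) = ns i" for i
    using assms by (simp add: part_perms_def)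
  show r: "\<pi> (inv_into UNIV \<pi> i) = i" for i
    using permutes_inverses(1)[OF \<pi>] by simp
  show "inv_into UNIV \<pi> (\<pi> i) = i" for i
    using permutes_inverses(2)[OF \<pi>] by simp
  show "i \<in> {1..l} \<Longrightarrow> ns (inv_into UNIV \<pi> i) = ns i" for i
    using ns[OF inv] r by simp
qed

text \<open>The functions a and M are arbitrary outside \<open>{1..l}\<close> here, in contrast to
  elements of \<open>srk_group\<close>, which are extensional there. This is the form in which the
  parameters occur in the pointwise characterization of isometries.\<close>

definition srk_params ::
  "nat \<Rightarrow> (nat \<Rightarrow> nat) \<Rightarrow> (nat \<Rightarrow> 'f::field) \<Rightarrow> (nat \<Rightarrow> 'e::field mat) \<Rightarrow> (nat \<Rightarrow> nat) \<Rightarrow> bool" where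
  "srk_params l ns a M \<pi> \<longleftrightarrow>
     (\<forall>i\<in>{1..l}. a i \<noteq> 0) \<and>
     (\<forall>i\<in>{1..l}. M i \<in> carrier (GL TYPE('e) (ns i))) \<and>
     \<pi> \<in> carrier (part_perms l ns)"

lemma srk_paramsD:
  fixes a :: "nat \<Rightarrow> 'f::field" and M :: "nat \<Rightarrow> 'e::field mat"
  assumes "srk_params l ns a M \<pi>"
  shows "i \<in> {1..l} \<Longrightarrow> a i \<noteq> 0"
    and "i \<in> {1..l} \<Longrightarrow> M i \<in> carrier (GL TYPE('e) (ns i))"
    and "i \<in> {1..l} \<Longrightarrow> M i \<in> carrier_mat (ns i) (ns i)"
    and "\<pi> \<in> carrier (part_perms l ns)"
  using assms by (auto simp: srk_params_def intro: GL_carrierD)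

text \<open>Allows parameters to be replaced by their restrictions to \<open>{1..l}\<close>, as
  membership in \<open>srk_group\<close> demands.\<close>

lemma srk_map_cong:
  assumes "\<And>i. i \<in> {1..l} \<Longrightarrow> a i = a' i" "\<And>i. i \<in> {1..l} \<Longrightarrow> M i = M' i"
  shows "srk_map h l ns a M \<pi> c = srk_map h l ns a' M' \<pi> c"
  unfolding srk_map_def using assms by (intro vec_concat_cong) simp

context
  fixes h :: "'e::field \<Rightarrow> 'f::field" and l ns and a :: "nat \<Rightarrow> 'f" and M :: "nat \<Rightarrow> 'e mat" and \<pi>
  assumes params: "srk_params l ns a M \<pi>"
begin

lemma srk_map_carrier: "srk_map h l ns a M \<pi> c \<in> carrier_vec (\<Sum>i=1..l. ns i)"
proof (rule carrier_vecI)
  have "dim_col (M i) = ns i" if "i \<in> {1..l}" for i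
    using srk_paramsD(3)[OF params that] by simp
  then show "dim_vec (srk_map h l ns a M \<pi> c) = (\<Sum>i=1..l. ns i)"
    by (simp add: srk_map_def row_mult_def)
qed

lemma vec_block_srk_map:
  assumes "i \<in> {1..l}"
  shows "vec_block ns i (srk_map h l ns a M \<pi> c) =
    a i \<cdot>\<^sub>v row_mult (vec_block ns (inv_into UNIV \<pi> i) c) (map_mat h (M i))"
  unfolding srk_map_def
proof (rule vec_block_vec_concat[OF _ assms])
  fix k assume "k \<in> {1..l}"
  from srk_paramsD(3)[OF params this]
  show "a k \<cdot>\<^sub>v row_mult (vec_block ns (inv_into UNIV \<pi> k) c) (map_mat h (M k)) \<in> carrier_vec (ns k)"
    by simp
qed

text \<open>This is where \<pi> has to respect block lengths: the block moved into position i must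
  fit the square matrix \<open>M i\<close>.\<close>

lemma vec_block_inv_carrier:
  assumes "i \<in> {1..l}"
  shows "vec_block ns (inv_into UNIV \<pi> i) c \<in> carrier_vec (ns i)"
  using vec_block_carrier[of ns "inv_into UNIV \<pi> i" c] part_permsD(5)[OF srk_paramsD(4)[OF params] assms]
  by simp

lemma vec_linear_srk_map: "vec_linear (\<Sum>i=1..l. ns i) (srk_map h l ns a M \<pi>)"
proof (rule vec_linearI)
  note perm = part_permsD[OF srk_paramsD(4)[OF params]]
  fix u v :: "'f vec"
  assume uv: "u \<in> carrier_vec (\<Sum>i=1..l. ns i)" "v \<in> carrier_vec (\<Sum>i=1..l. ns i)"
  show "srk_map h l ns a M \<pi> (u + v) = srk_map h l ns a M \<pi> u + srk_map h l ns a M \<pi> v"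
  proof (rule vec_eq_blockwise)
    fix i assume i: "i \<in> {1..l}"
    show "vec_block ns i (srk_map h l ns a M \<pi> (u + v)) =
        vec_block ns i (srk_map h l ns a M \<pi> u + srk_map h l ns a M \<pi> v)"
      using srk_paramsD(3)[OF params i]
      by (simp add: vec_block_add[OF srk_map_carrier srk_map_carrier i] vec_block_srk_map[OF i]
          vec_block_add[OF uv perm(3)[OF i]] vec_block_inv_carrier[OF i]
          row_mult_add[where k = "ns i" and m = "ns i"] smult_add_distrib_vec[where n = "ns i"])
  qed (simp_all only: add_carrier_vec srk_map_carrier)
next
  note perm = part_permsD[OF srk_paramsD(4)[OF params]]
  fix b and u :: "'f vec"
  assume u: "u \<in> carrier_vec (\<Sum>i=1..l. ns i)"
  show "srk_map h l ns a M \<pi> (b \<cdot>\<^sub>v u) = b \<cdot>\<^sub>v srk_map h l ns a M \<pi> u"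
  proof (rule vec_eq_blockwise)
    fix i assume i: "i \<in> {1..l}"
    show "vec_block ns i (srk_map h l ns a M \<pi> (b \<cdot>\<^sub>v u)) =
        vec_block ns i (b \<cdot>\<^sub>v srk_map h l ns a M \<pi> u)"
      using srk_paramsD(3)[OF params i]
      by (simp add: vec_block_smult[OF srk_map_carrier i] vec_block_srk_map[OF i]
          vec_block_smult[OF u perm(3)[OF i]] vec_block_inv_carrier[OF i]
          row_mult_smult[where k = "ns i" and m = "ns i"] smult_smult_assoc mult.commute)
  qed (simp_all only: smult_carrier_vec srk_map_carrier)
qed (rule srk_map_carrier)

end

text \<open>Scalars and invertible matrices preserve the rank weight of each block, and the
  permutation merely reorders the sum.\<close>

lemma (in finite_degree_ext) srk_weight_srk_map:
  fixes M :: "nat \<Rightarrow> 'e mat"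
  assumes params: "srk_params l ns a M \<pi>"
  shows "srk_weight h l ns (srk_map h l ns a M \<pi> c) = srk_weight h l ns c"
proof -
  have \<pi>: "\<pi> permutes {1..l}"
    using part_permsD(1)[OF srk_paramsD(4)[OF params]] .
  have "srk_weight h l ns (srk_map h l ns a M \<pi> c) =
      (\<Sum>i=1..l. rk_weight h (vec_block ns (inv_into UNIV \<pi> i) c))"
    unfolding srk_weight_def
    by (intro sum.cong refl) (simp add: vec_block_srk_map[OF params] rk_weight_smult srk_paramsD[OF params]
      rk_weight_row_mult[OF srk_paramsD(2)[OF params]] vec_block_inv_carrier[OF params])
  also have "\<dots> = srk_weight h l ns c"
    unfolding srk_weight_def
    by (rule sum.permute[OF permutes_inv[OF \<pi>], symmetric, unfolded comp_def])
  finally show ?thesis .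
qed

section \<open>Vectors supported in a single block\<close>

definition block_embed :: "nat \<Rightarrow> (nat \<Rightarrow> nat) \<Rightarrow> nat \<Rightarrow> 'f::field vec \<Rightarrow> 'f vec" where
  "block_embed l ns i v = vec_concat l (\<lambda>k. if k = i then v else 0\<^sub>v (ns k))"

lemma vec_block_embed:
  assumes "v \<in> carrier_vec (ns i)" "k \<in> {1..l}"
  shows "vec_block ns k (block_embed l ns i v) = (if k = i then v else 0\<^sub>v (ns k))"
  unfolding block_embed_def using assms by (subst vec_block_vec_concat) auto

lemma block_embed_carrier:
  assumes "v \<in> carrier_vec (ns i)"
  shows "block_embed l ns i v \<in> carrier_vec (\<Sum>i=1..l. ns i)"
  by (rule carrier_vecI) (use assms in \<open>auto simp: block_embed_def intro!: sum.cong\<close>)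

lemma block_embed_add:
  assumes "u \<in> carrier_vec (ns i)" "v \<in> carrier_vec (ns i)"
  shows "block_embed l ns i (u + v) = block_embed l ns i u + block_embed l ns i v"
proof (rule vec_eq_blockwise)
  note car = assms[THEN block_embed_carrier[where ns = ns and i = i and l = l]]
  fix k assume k: "k \<in> {1..l}"
  show "vec_block ns k (block_embed l ns i (u + v)) =
      vec_block ns k (block_embed l ns i u + block_embed l ns i v)"
    unfolding vec_block_add[OF car k] using assms k by (simp add: vec_block_embed)
qed (intro add_carrier_vec block_embed_carrier[where ns = ns and i = i] assms)+

lemma block_embed_smult:
  assumes "v \<in> carrier_vec (ns i)"
  shows "block_embed l ns i (a \<cdot>\<^sub>v v) = a \<cdot>\<^sub>v block_embed l ns i v"
proof (rule vec_eq_blockwise)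
  note car = assms[THEN block_embed_carrier[where ns = ns and i = i and l = l]]
  fix k assume k: "k \<in> {1..l}"
  show "vec_block ns k (block_embed l ns i (a \<cdot>\<^sub>v v)) = vec_block ns k (a \<cdot>\<^sub>v block_embed l ns i v)"
    unfolding vec_block_smult[OF car k] using assms k by (auto simp: vec_block_embed)
qed (simp_all only: smult_carrier_vec block_embed_carrier[where ns = ns and i = i] assms)

text \<open>Through this identity a linear map on full vectors is determined by its values on
  embedded unit vectors of the blocks.\<close>

lemma unit_vec_eq_block_embed:
  assumes "i \<in> {1..l}" "j < ns i"
  shows "unit_vec (\<Sum>i=1..l. ns i) ((\<Sum>k\<in>{1..<i}. ns k) + j) = block_embed l ns i (unit_vec (ns i) j)"
proof (rule vec_eq_blockwise)
  fix k assume k: "k \<in> {1..l}"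
  \<comment> \<open>Different blocks occupy disjoint ranges of indices: \<open>offset_le\<close>,
    used with the predecessor of the later block in place of \<open>l\<close>, says that the earlier
    block ends before the later one begins.\<close>
  have "(\<Sum>m\<in>{1..<k}. ns m) + r \<noteq> (\<Sum>m\<in>{1..<i}. ns m) + j" if "r < ns k" "k \<noteq> i" for r
  proof (cases "k < i")
    case True
    then show ?thesis
      using offset_le[of k "i - 1" ns] that k by (cases i) (auto simp: atLeastLessThanSuc_atLeastAtMost)
  next
    case False
    then show ?thesis
      using offset_le[of i "k - 1" ns] that k assms by (cases k) (auto simp: atLeastLessThanSuc_atLeastAtMost)
  qed
  then have "vec_block ns k (unit_vec (\<Sum>i=1..l. ns i) ((\<Sum>k\<in>{1..<i}. ns k) + j)) =
      (if k = i then unit_vec (ns i) j else 0\<^sub>v (ns k))"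
    using offset_le[OF k, of ns] offset_le[OF assms(1), of ns]
    by (cases "k = i") (auto simp: vec_block_def unit_vec_def)
  also have "\<dots> = vec_block ns k (block_embed l ns i (unit_vec (ns i) j))"
    using k by (simp add: vec_block_embed)
  finally show "vec_block ns k (unit_vec (\<Sum>i=1..l. ns i) ((\<Sum>k\<in>{1..<i}. ns k) + j)) =
      vec_block ns k (block_embed l ns i (unit_vec (ns i) j))" .
qed (simp_all only: unit_vec_carrier block_embed_carrier[where ns = ns and i = i])

lemma (in finite_degree_ext) rk_weight_zero [simp]: "rk_weight h (0\<^sub>v m) = 0"
  using rk_weight_eq_0_iff[of "0\<^sub>v m" m] by simp

lemma (in finite_degree_ext) srk_weight_block_embed:
  assumes "v \<in> carrier_vec (ns i)" "i \<in> {1..l}"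
  shows "srk_weight h l ns (block_embed l ns i v) = rk_weight h v"
proof -
  have "srk_weight h l ns (block_embed l ns i v) = (\<Sum>k=1..l. if k = i then rk_weight h v else 0)"
    unfolding srk_weight_def using assms
    by (intro sum.cong refl) (auto simp: vec_block_embed)
  then show ?thesis
    using assms by simp
qed

text \<open>\<open>srk_map\<close> indexes its parameters by the target block. The content of block
  i arrives in block \<open>\<pi> i\<close>, so it meets the scalar and the matrix stored at
  \<open>\<pi> i\<close>.\<close>

lemma srk_map_block_embed:
  fixes h :: "'e::field \<Rightarrow> 'f::field"
  assumes params: "srk_params l ns a M \<pi>" and v: "v \<in> carrier_vec (ns i)" and i: "i \<in> {1..l}"
  shows "srk_map h l ns a M \<pi> (block_embed l ns i v) =
    block_embed l ns (\<pi> i) (a (\<pi> i) \<cdot>\<^sub>v row_mult v (map_mat h (M (\<pi> i))))"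
proof (rule vec_eq_blockwise)
  note perm = part_permsD[OF srk_paramsD(4)[OF params]]
  have car: "a (\<pi> i) \<cdot>\<^sub>v row_mult v (map_mat h (M (\<pi> i))) \<in> carrier_vec (ns (\<pi> i))"
    using srk_paramsD(3)[OF params perm(2)[OF i]] by simp
  then show "block_embed l ns (\<pi> i) (a (\<pi> i) \<cdot>\<^sub>v row_mult v (map_mat h (M (\<pi> i))))
      \<in> carrier_vec (\<Sum>i=1..l. ns i)"
    by (rule block_embed_carrier[where ns = ns and i = "\<pi> i"])
  fix k assume k: "k \<in> {1..l}"
  have "inv_into UNIV \<pi> k = i \<longleftrightarrow> k = \<pi> i"
    using perm(6)[of k] perm(7)[of i] by auto
  then show "vec_block ns k (srk_map h l ns a M \<pi> (block_embed l ns i v)) =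
      vec_block ns k (block_embed l ns (\<pi> i) (a (\<pi> i) \<cdot>\<^sub>v row_mult v (map_mat h (M (\<pi> i)))))"
    unfolding vec_block_srk_map[OF params k] vec_block_embed[where ns = ns and i = i and v = v, OF v perm(3)[OF k]]
      vec_block_embed[where ns = ns and i = "\<pi> i", OF car k]
    using row_mult_zero[of "map_mat h (M k)" "ns k" "ns k"] srk_paramsD(3)[OF params k] perm(5)[OF k] by auto
qed (rule srk_map_carrier[OF params])

section \<open>The group and its action\<close>

lemma opposite_group_group:
  assumes "group G"
  shows "group (opposite_group G)"
proof -
  interpret group G by fact
  show ?thesis
    by (rule groupI) (auto simp: opposite_group_def m_assoc intro: r_inv)
qed

text \<open>Requiring each \<open>\<theta> p\<close> to be an endomorphism is enough: with the laws
  for products and the unit, the inverse of p makes it bijective. \<open>groupI\<close> asks for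
  left inverses, and the one of \<open>(a, p)\<close> is obtained by applying
  \<open>\<theta>\<close> at the inverse of p to the inverse of a.\<close>

lemma semidirect_product_group:
  assumes N: "group N" and H: "group H"
    and hom: "\<And>p. p \<in> carrier H \<Longrightarrow> \<theta> p \<in> hom N N"
    and mult: "\<And>p q x. p \<in> carrier H \<Longrightarrow> q \<in> carrier H \<Longrightarrow> x \<in> carrier N \<Longrightarrow>
      \<theta> (p \<otimes>\<^bsub>H\<^esub> q) x = \<theta> p (\<theta> q x)"
    and one: "\<And>x. x \<in> carrier N \<Longrightarrow> \<theta> \<one>\<^bsub>H\<^esub> x = x"
  shows "group (semidirect_product N H \<theta>)"
proof -
  interpret N: group N by fact
  interpret H: group H by fact
  have closed: "\<theta> p x \<in> carrier N" if "p \<in> carrier H" "x \<in> carrier N" for p x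
    using hom[OF that(1)] that(2) by (auto simp: hom_def)
  have dist: "\<theta> p (x \<otimes>\<^bsub>N\<^esub> y) = \<theta> p x \<otimes>\<^bsub>N\<^esub> \<theta> p y"
    if "p \<in> carrier H" "x \<in> carrier N" "y \<in> carrier N" for p x y
    using hom[OF that(1)] that(2,3) by (auto simp: hom_def)
  show ?thesis
  proof (rule groupI)
    fix x assume "x \<in> carrier (semidirect_product N H \<theta>)"
    then obtain a p where x: "x = (a, p)" "a \<in> carrier N" "p \<in> carrier H"
      by (auto simp: semidirect_product_def)
    have "\<theta> (inv\<^bsub>H\<^esub> p) (inv\<^bsub>N\<^esub> a) \<otimes>\<^bsub>N\<^esub> \<theta> (inv\<^bsub>H\<^esub> p) a = \<theta> (inv\<^bsub>H\<^esub> p) \<one>\<^bsub>N\<^esub>"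
      using x by (simp flip: dist)
    also have "\<dots> = \<one>\<^bsub>N\<^esub>"
      using hom[of "inv\<^bsub>H\<^esub> p"] x hom_one[OF _ N N] by simp
    finally show "\<exists>y\<in>carrier (semidirect_product N H \<theta>).
        y \<otimes>\<^bsub>semidirect_product N H \<theta>\<^esub> x = \<one>\<^bsub>semidirect_product N H \<theta>\<^esub>"
      using x closed
      by (intro bexI[of _ "(\<theta> (inv\<^bsub>H\<^esub> p) (inv\<^bsub>N\<^esub> a), inv\<^bsub>H\<^esub> p)"]) (auto simp: semidirect_product_def)
  qed (auto simp: semidirect_product_def closed dist mult one N.m_assoc H.m_assoc)
qed

text \<open>These permutations form the stabilizer of the labelling of the blocks by their
  lengths.\<close>

lemma part_perms_group: "group (part_perms l ns)"
proof -
  interpret S: group "sym_group l"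
    by (rule sym_group_is_group)
  have "subgroup {\<pi> \<in> carrier (sym_group l). \<forall>i\<in>{1..l}. ns (\<pi> i) = ns i} (sym_group l)"
  proof (rule S.subgroupI)
    fix \<pi> assume \<pi>: "\<pi> \<in> {\<pi> \<in> carrier (sym_group l). \<forall>i\<in>{1..l}. ns (\<pi> i) = ns i}"
    then have "\<pi> \<in> carrier (part_perms l ns)"
      by (simp add: part_perms_def)
    then have "\<forall>i\<in>{1..l}. ns (inv_into UNIV \<pi> i) = ns i"
      using part_permsD(5) by blast
    then show "inv\<^bsub>sym_group l\<^esub> \<pi> \<in> {\<pi> \<in> carrier (sym_group l). \<forall>i\<in>{1..l}. ns (\<pi> i) = ns i}"
      using \<pi> sym_group_inv_closed by auto
  next
    fix \<pi> \<sigma>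
    assume "\<pi> \<in> {\<pi> \<in> carrier (sym_group l). \<forall>i\<in>{1..l}. ns (\<pi> i) = ns i}"
      "\<sigma> \<in> {\<pi> \<in> carrier (sym_group l). \<forall>i\<in>{1..l}. ns (\<pi> i) = ns i}"
    then show "\<pi> \<otimes>\<^bsub>sym_group l\<^esub> \<sigma> \<in> {\<pi> \<in> carrier (sym_group l). \<forall>i\<in>{1..l}. ns (\<pi> i) = ns i}"
      using permutes_in_image[of \<sigma> "{1..l}"]
      by (auto simp: sym_group_carrier sym_group_mult permutes_compose simp del: atLeastAtMost_iff)
  next
    have "id \<in> {\<pi> \<in> carrier (sym_group l). \<forall>i\<in>{1..l}. ns (\<pi> i) = ns i}"
      by (simp add: sym_group_carrier permutes_id)
    then show "{\<pi> \<in> carrier (sym_group l). \<forall>i\<in>{1..l}. ns (\<pi> i) = ns i} \<noteq> {}"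
      by blast
  qed auto
  then show ?thesis
    unfolding part_perms_def by (rule S.subgroup_imp_group)
qed

lemma part_perms_simps:
  "\<pi> \<otimes>\<^bsub>part_perms l ns\<^esub> \<sigma> = \<pi> \<circ> \<sigma>" "\<one>\<^bsub>part_perms l ns\<^esub> = id"
  by (simp_all add: part_perms_def sym_group_mult sym_group_one)

lemma GL_group: "group (GL TYPE('e::field) k)"
proof -
  interpret ring "ring_mat TYPE('e) k ()"
    by (rule ring_mat)
  show ?thesis
    by (rule units_group)
qed

lemma field_units_group: "group (field_units TYPE('f::field))"
  by (rule class_semiring.units_group)

lemma field_units_carrier: "carrier (field_units TYPE('f::field)) = {a. a \<noteq> 0}"
proof -
  have "Units (class_ring :: 'f ring) = carrier class_ring - {\<zero>\<^bsub>class_ring\<^esub>}"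
    by (rule field.field_Units[OF class_field])
  then show ?thesis
    by (auto simp: units_of_carrier class_ring_simps)
qed

lemma scalar_matrix_group_group: "group (scalar_matrix_group TYPE('e::field) TYPE('f::field) l ns)"
  unfolding scalar_matrix_group_def
  by (intro DirProd_group product_group field_units_group opposite_group_group GL_group)

lemma carrier_scalar_matrix_group:
  "carrier (scalar_matrix_group TYPE('e::field) TYPE('f::field) l ns) =
    (\<Pi>\<^sub>E i\<in>{1..l}. {a. a \<noteq> 0}) \<times> (\<Pi>\<^sub>E i\<in>{1..l}. carrier (GL TYPE('e) (ns i)))"
  unfolding scalar_matrix_group_def
  by (simp add: field_units_carrier opposite_group_def del: atLeastAtMost_iff)

lemma mult_scalar_matrix_group:
  "(a, M) \<otimes>\<^bsub>scalar_matrix_group TYPE('e::field) TYPE('f::field) l ns\<^esub> (a', M') =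
    (\<lambda>i\<in>{1..l}. a i * a' i, \<lambda>i\<in>{1..l}. M' i * M i)"
  by (simp add: scalar_matrix_group_def opposite_group_def units_of_mult class_ring_simps ring_mat_simps)

lemma srk_group_group: "group (srk_group TYPE('e::field) TYPE('f::field) l ns)"
  unfolding srk_group_def
proof (rule semidirect_product_group[OF scalar_matrix_group_group part_perms_group])
  fix \<pi> assume \<pi>: "\<pi> \<in> carrier (part_perms l ns)"
  note perm = part_permsD[OF \<pi>]
  show "permute_components l \<pi> \<in> hom (scalar_matrix_group TYPE('e) TYPE('f) l ns) (scalar_matrix_group TYPE('e) TYPE('f) l ns)"
  proof (rule homI)
    fix x assume "x \<in> carrier (scalar_matrix_group TYPE('e) TYPE('f) l ns)"
    \<comment> \<open>The matrix moved into position i comes from the general linear group of the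
      length of block \<open>inv_into UNIV \<pi> i\<close>, which is the group expected at i because
      these lengths agree.\<close>
    then show "permute_components l \<pi> x \<in> carrier (scalar_matrix_group TYPE('e) TYPE('f) l ns)"
      unfolding carrier_scalar_matrix_group permute_components_def
      using perm(3,5) by (fastforce simp: PiE_iff simp del: atLeastAtMost_iff)
  next
    fix x y
    show "permute_components l \<pi> (x \<otimes>\<^bsub>scalar_matrix_group TYPE('e) TYPE('f) l ns\<^esub> y) =
        permute_components l \<pi> x \<otimes>\<^bsub>scalar_matrix_group TYPE('e) TYPE('f) l ns\<^esub> permute_components l \<pi> y"
      using perm(3)
      by (cases x; cases y)
        (auto simp: mult_scalar_matrix_group permute_components_def restrict_def fun_eq_iff
          simp del: atLeastAtMost_iff)
  qed
  fix \<sigma> x assume \<sigma>: "\<sigma> \<in> carrier (part_perms l ns)"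
  \<comment> \<open>Reading components through the inverse permutation reverses composition, and so
    does precomposition with the index map. The two reversals cancel, which makes the permutation of
    components a left action.\<close>
  have "inv_into UNIV (\<pi> \<circ> \<sigma>) = inv_into UNIV \<sigma> \<circ> inv_into UNIV \<pi>"
    using part_permsD(1)[OF \<pi>] part_permsD(1)[OF \<sigma>] by (simp add: o_inv_distrib permutes_bij)
  then show "permute_components l (\<pi> \<otimes>\<^bsub>part_perms l ns\<^esub> \<sigma>) x =
      permute_components l \<pi> (permute_components l \<sigma> x)"
    using perm(3) by (cases x) (auto simp: part_perms_simps permute_components_def restrict_def fun_eq_iff
          simp del: atLeastAtMost_iff)
next
  fix x assume "x \<in> carrier (scalar_matrix_group TYPE('e) TYPE('f) l ns)"
  then show "permute_components l \<one>\<^bsub>part_perms l ns\<^esub> x = x"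
    by (auto simp: carrier_scalar_matrix_group part_perms_simps permute_components_def
      inv_id PiE_iff extensional_restrict simp del: atLeastAtMost_iff)
qed

lemma carrier_srk_group_iff:
  "((a, M), \<pi>) \<in> carrier (srk_group TYPE('e::field) TYPE('f::field) l ns) \<longleftrightarrow>
    srk_params l ns a M \<pi> \<and> a \<in> extensional {1..l} \<and> M \<in> extensional {1..l}"
  unfolding srk_group_def semidirect_product_def
  by (auto simp: carrier_scalar_matrix_group srk_params_def PiE_iff simp del: atLeastAtMost_iff)

lemma mult_srk_group:
  assumes "\<pi> \<in> carrier (part_perms l ns)"
  shows "((a, M), \<pi>) \<otimes>\<^bsub>srk_group TYPE('e::field) TYPE('f::field) l ns\<^esub> ((a', M'), \<pi>') =
    ((\<lambda>i\<in>{1..l}. a i * a' (inv_into UNIV \<pi> i), \<lambda>i\<in>{1..l}. M' (inv_into UNIV \<pi> i) * M i), \<pi> \<circ> \<pi>')"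
  by (auto simp: srk_group_def semidirect_product_def permute_components_def mult_scalar_matrix_group
    part_perms_simps cong: restrict_cong simp del: atLeastAtMost_iff)

section \<open>The parameters acting on vectors\<close>

context finite_degree_ext
begin

text \<open>Block i of the outer map reads block j of the inner image, where j is the preimage of i
  under \<pi>, so the inner parameters appear at j. The inner scalar passes through the outer
  matrix, and row multiplication composes the matrices as \<open>M' j * M i\<close>. This is the
  product in \<open>srk_group\<close>, where the matrix factors carry the opposite
  multiplication.\<close>

lemma srk_map_srk_map:
  fixes M M' :: "nat \<Rightarrow> 'e mat"
  assumes params: "srk_params l ns a M \<pi>" and params': "srk_params l ns a' M' \<pi>'"
  shows "srk_map h l ns a M \<pi> (srk_map h l ns a' M' \<pi>' c) =
    srk_map h l ns (\<lambda>i. a i * a' (inv_into UNIV \<pi> i)) (\<lambda>i. M' (inv_into UNIV \<pi> i) * M i) (\<pi> \<circ> \<pi>') c"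
  unfolding srk_map_def[of h l ns a M] srk_map_def[of _ _ _ "\<lambda>i. _ i * _ i"]
proof (rule vec_concat_cong)
  note perm = part_permsD[OF srk_paramsD(4)[OF params]]
  note perm' = part_permsD[OF srk_paramsD(4)[OF params']]
  fix i assume i: "i \<in> {1..l}"
  define j where "j = inv_into UNIV \<pi> i"
  have j: "j \<in> {1..l}" "ns j = ns i"
    using perm(3,5)[OF i] by (simp_all add: j_def)
  have inv: "inv_into UNIV (\<pi> \<circ> \<pi>') i = inv_into UNIV \<pi>' j"
    using perm(1) perm'(1) by (simp add: o_inv_distrib permutes_bij j_def)
  have M: "M i \<in> carrier_mat (ns i) (ns i)" "M' j \<in> carrier_mat (ns i) (ns i)"
    using srk_paramsD(3)[OF params i] srk_paramsD(3)[OF params' j(1)] j(2) by simp_all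
  have v: "vec_block ns (inv_into UNIV \<pi>' j) c \<in> carrier_vec (ns i)"
    using vec_block_inv_carrier[OF params' j(1)] j(2) by simp
  have "row_mult (a' j \<cdot>\<^sub>v row_mult (vec_block ns (inv_into UNIV \<pi>' j) c) (map_mat h (M' j))) (map_mat h (M i)) =
      a' j \<cdot>\<^sub>v row_mult (row_mult (vec_block ns (inv_into UNIV \<pi>' j) c) (map_mat h (M' j))) (map_mat h (M i))"
    using M by (intro row_mult_smult) auto
  also have "\<dots> = a' j \<cdot>\<^sub>v row_mult (vec_block ns (inv_into UNIV \<pi>' j) c) (map_mat h (M' j * M i))"
    using M v by (simp add: row_mult_row_mult[where k = "ns i" and m = "ns i" and p = "ns i"]
      mat_hom_mult[where n = "ns i" and nr = "ns i" and nc = "ns i"])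
  finally show "a i \<cdot>\<^sub>v row_mult (vec_block ns (inv_into UNIV \<pi> i) (srk_map h l ns a' M' \<pi>' c)) (map_mat h (M i)) =
      (a i * a' (inv_into UNIV \<pi> i)) \<cdot>\<^sub>v
      row_mult (vec_block ns (inv_into UNIV (\<pi> \<circ> \<pi>') i) c) (map_mat h (M' (inv_into UNIV \<pi> i) * M i))"
    using j(1) by (simp add: inv vec_block_srk_map[OF params'] smult_smult_assoc flip: j_def)
qed

lemma srk_map_one:
  assumes "c \<in> carrier_vec (\<Sum>i=1..l. ns i)" "\<And>i. i \<in> {1..l} \<Longrightarrow> a i = 1" "\<And>i. i \<in> {1..l} \<Longrightarrow> M i = 1\<^sub>m (ns i)"
  shows "srk_map h l ns a M id c = c"
proof -
  have eq: "srk_map h l ns a M id c = vec_concat l (\<lambda>i. vec_block ns i c)"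
    unfolding srk_map_def by (rule vec_concat_cong) (simp add: assms(2,3) mat_hom_one inv_id)
  show ?thesis
    unfolding eq
  proof (rule vec_eq_blockwise)
    show "vec_concat l (\<lambda>i. vec_block ns i c) \<in> carrier_vec (\<Sum>i=1..l. ns i)"
      by (rule carrier_vecI) (simp add: vec_block_def)
    show "vec_block ns i (vec_concat l (\<lambda>i. vec_block ns i c)) = vec_block ns i c" if "i \<in> {1..l}" for i
      by (rule vec_block_vec_concat[OF vec_block_carrier that])
  qed (rule assms(1))
qed

lemma one_srk_group:
  "\<one>\<^bsub>srk_group TYPE('e) TYPE('f) l ns\<^esub> = ((\<lambda>i\<in>{1..l}. 1, \<lambda>i\<in>{1..l}. 1\<^sub>m (ns i)), id)"
  by (simp add: srk_group_def semidirect_product_def scalar_matrix_group_def opposite_group_def units_of_one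
      part_perms_simps class_ring_simps ring_mat_simps)

lemma srk_action_carrier:
  assumes g: "g \<in> carrier (srk_group TYPE('e) TYPE('f) l ns)" and n: "n = (\<Sum>i=1..l. ns i)"
    and c: "c \<in> carrier_vec n"
  shows "srk_action h l ns n g c \<in> carrier_vec n"
proof -
  obtain a M \<pi> where g_eq: "g = ((a, M), \<pi>)"
    by (metis prod.exhaust)
  with g have "srk_params l ns a M \<pi>"
    by (simp add: carrier_srk_group_iff)
  from srk_map_carrier[OF this] show ?thesis
    using c by (simp add: g_eq srk_action_def n)
qed

lemma srk_action_one:
  assumes "c \<in> carrier_vec n" "n = (\<Sum>i=1..l. ns i)"
  shows "srk_action h l ns n \<one>\<^bsub>srk_group TYPE('e) TYPE('f) l ns\<^esub> c = c"
proof -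
  have "srk_map h l ns (\<lambda>i\<in>{1..l}. 1) (\<lambda>i\<in>{1..l}. 1\<^sub>m (ns i)) id c = c"
    using assms by (intro srk_map_one) simp_all
  then show ?thesis
    using assms(1) by (simp add: srk_action_def one_srk_group)
qed

lemma srk_action_mult:
  assumes g: "g \<in> carrier (srk_group TYPE('e) TYPE('f) l ns)"
    and g': "g' \<in> carrier (srk_group TYPE('e) TYPE('f) l ns)"
    and n: "n = (\<Sum>i=1..l. ns i)" and c: "c \<in> carrier_vec n"
  shows "srk_action h l ns n (g \<otimes>\<^bsub>srk_group TYPE('e) TYPE('f) l ns\<^esub> g') c =
    srk_action h l ns n g (srk_action h l ns n g' c)"
proof -
  obtain a M \<pi> a' M' \<pi>' where eq: "g = ((a, M), \<pi>)" "g' = ((a', M'), \<pi>')"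
    by (metis prod.exhaust)
  then have params: "srk_params l ns a M \<pi>" "srk_params l ns a' M' \<pi>'"
    using g g' by (simp_all add: carrier_srk_group_iff)
  have "srk_action h l ns n (g \<otimes>\<^bsub>srk_group TYPE('e) TYPE('f) l ns\<^esub> g') c =
      srk_map h l ns (\<lambda>i\<in>{1..l}. a i * a' (inv_into UNIV \<pi> i)) (\<lambda>i\<in>{1..l}. M' (inv_into UNIV \<pi> i) * M i) (\<pi> \<circ> \<pi>') c"
    unfolding eq mult_srk_group[OF srk_paramsD(4)[OF params(1)]] using c by (simp add: srk_action_def)
  also have "\<dots> = srk_map h l ns (\<lambda>i. a i * a' (inv_into UNIV \<pi> i)) (\<lambda>i. M' (inv_into UNIV \<pi> i) * M i) (\<pi> \<circ> \<pi>') c"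
    by (rule srk_map_cong) simp_all
  also have "\<dots> = srk_map h l ns a M \<pi> (srk_map h l ns a' M' \<pi>' c)"
    by (simp add: srk_map_srk_map[OF params])
  also have "\<dots> = srk_action h l ns n g (srk_action h l ns n g' c)"
    unfolding srk_action_def eq using c srk_map_carrier[OF params(2), of h c] n by simp
  finally show ?thesis .
qed

text \<open>Bijectivity comes from the group: the map of the inverse element is a two-sided inverse
  map. Since \<open>srk_action\<close> is restricted to the vectors of length n, its maps are
  extensional, as \<open>Bij\<close> requires.\<close>

lemma group_action_srk_action:
  assumes n: "n = (\<Sum>i=1..l. ns i)"
  shows "group_action (srk_group TYPE('e) TYPE('f) l ns) (carrier_vec n) (srk_action h l ns n)"
proof -
  let ?G = "srk_group TYPE('e) TYPE('f) l ns"
  interpret G: group ?G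
    by (rule srk_group_group)
  have inverse: "srk_action h l ns n (inv\<^bsub>?G\<^esub> g) (srk_action h l ns n g c) = c"
      "srk_action h l ns n g (srk_action h l ns n (inv\<^bsub>?G\<^esub> g) c) = c"
    if "g \<in> carrier ?G" "c \<in> carrier_vec n" for g c
    using that n by (simp_all flip: srk_action_mult add: srk_action_one)
  have "srk_action h l ns n g \<in> Bij (carrier_vec n)" if "g \<in> carrier ?G" for g
    unfolding Bij_def
  proof
    show "srk_action h l ns n g \<in> extensional (carrier_vec n)"
      by (auto simp: srk_action_def split: prod.split)
    have "bij_betw (srk_action h l ns n g) (carrier_vec n) (carrier_vec n)"
      by (rule bij_betw_byWitness[where f' = "srk_action h l ns n (inv\<^bsub>?G\<^esub> g)"])
        (use that n inverse srk_action_carrier[OF that n] srk_action_carrier[OF G.inv_closed[OF that] n] in blast)+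
    then show "srk_action h l ns n g \<in> {f. bij_betw f (carrier_vec n) (carrier_vec n)}"
      by simp
  qed
  moreover have "srk_action h l ns n (g \<otimes>\<^bsub>?G\<^esub> g') =
      compose (carrier_vec n) (srk_action h l ns n g) (srk_action h l ns n g')"
    if "g \<in> carrier ?G" "g' \<in> carrier ?G" for g g'
  proof (rule extensionalityI)
    show "srk_action h l ns n (g \<otimes>\<^bsub>?G\<^esub> g') \<in> extensional (carrier_vec n)"
      by (auto simp: srk_action_def split: prod.split)
  qed (use that n in \<open>auto simp: compose_def srk_action_mult\<close>)
  ultimately have "srk_action h l ns n \<in> hom ?G (BijGroup (carrier_vec n))"
    by (intro homI) (auto simp: BijGroup_def)
  then show ?thesis
    by (simp add: group_action_def group_hom_def group_hom_axioms_def group_BijGroup G.is_group)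
qed

end

section \<open>Linear isometries\<close>

context finite_degree_ext
begin

lemma rk_weight_smult_hom:
  assumes "a \<noteq> 0" "w \<in> carrier_vec m" "w \<noteq> 0\<^sub>v m"
  shows "rk_weight h (a \<cdot>\<^sub>v map_vec h w) = 1"
proof -
  obtain k where "k < m" "w $ k \<noteq> 0"
    using assms(2,3) by (auto simp: vec_eq_iff)
  then have "(a \<cdot>\<^sub>v map_vec h w) $ k \<noteq> 0\<^sub>v m $ k"
    using assms(1,2) by simp
  then have "a \<cdot>\<^sub>v map_vec h w \<noteq> 0\<^sub>v m"
    by metis
  then have "rk_weight h (a \<cdot>\<^sub>v map_vec h w) \<noteq> 0"
    using rk_weight_eq_0_iff[of "a \<cdot>\<^sub>v map_vec h w" m] assms(2) by simp
  then show ?thesis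
    using rk_weight_smult_hom_le[of a w] by linarith
qed

lemma srk_weight_eq_0D:
  assumes "srk_weight h l ns c = 0" "c \<in> carrier_vec (\<Sum>i=1..l. ns i)"
  shows "c = 0\<^sub>v (\<Sum>i=1..l. ns i)"
proof (rule vec_eq_blockwise)
  fix i assume i: "i \<in> {1..l}"
  then have "rk_weight h (vec_block ns i c) = 0"
    using assms(1) by (simp add: srk_weight_def)
  then show "vec_block ns i c = vec_block ns i (0\<^sub>v (\<Sum>i=1..l. ns i))"
    unfolding vec_block_zero[OF i] by (simp add: rk_weight_eq_0_iff[OF vec_block_carrier])
qed (use assms in simp_all)

text \<open>A sum of natural numbers equals 1 only if one term is 1 and all others vanish, so
  exactly one block is nonzero and it has rank weight 1.\<close>

lemma srk_weight_eq_1E: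
  assumes "srk_weight h l ns c = 1" "c \<in> carrier_vec (\<Sum>i=1..l. ns i)"
  obtains p b w where "p \<in> {1..l}" "b \<noteq> 0" "w \<in> carrier_vec (ns p)" "w \<noteq> 0\<^sub>v (ns p)"
    "c = block_embed l ns p (b \<cdot>\<^sub>v map_vec h w)"
proof -
  have "\<exists>p\<in>{1..l}. rk_weight h (vec_block ns p c) = 1 \<and>
      (\<forall>k\<in>{1..l}. p \<noteq> k \<longrightarrow> rk_weight h (vec_block ns k c) = 0)"
    using assms(1) unfolding srk_weight_def by (rule sum_eq_1_iff[THEN iffD1, rotated]) simp
  then obtain p where p: "p \<in> {1..l}" "rk_weight h (vec_block ns p c) = 1"
    and "\<forall>k\<in>{1..l}. p \<noteq> k \<longrightarrow> rk_weight h (vec_block ns k c) = 0"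
    by (elim bexE conjE)
  then have zero: "rk_weight h (vec_block ns k c) = 0" if "k \<in> {1..l}" "k \<noteq> p" for k
    using that by simp
  have dim: "dim_vec (vec_block ns k c) = ns k" for k
    by (simp add: vec_block_def)
  obtain b w where bw: "b \<noteq> 0" "w \<in> carrier_vec (ns p)" "w \<noteq> 0\<^sub>v (ns p)" "vec_block ns p c = b \<cdot>\<^sub>v map_vec h w"
    using rk_weight_eq_1E[OF p(2)] unfolding dim .
  have car: "b \<cdot>\<^sub>v map_vec h w \<in> carrier_vec (ns p)"
    using bw(2) by simp
  have "c = block_embed l ns p (b \<cdot>\<^sub>v map_vec h w)"
  proof (rule vec_eq_blockwise)
    fix k assume k: "k \<in> {1..l}"
    show "vec_block ns k c = vec_block ns k (block_embed l ns p (b \<cdot>\<^sub>v map_vec h w))"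
      unfolding vec_block_embed[where ns = ns and i = p, OF car k]
      using zero[OF k] by (cases "k = p") (simp_all add: bw(4) rk_weight_eq_0_iff[OF vec_block_carrier])
  qed (rule assms(2), rule block_embed_carrier[where ns = ns and i = p, OF car])
  with p(1) bw(1-3) show thesis
    by (rule that)
qed

lemma srk_weight_block_embed_add:
  assumes u: "u \<in> carrier_vec (ns p)" and v: "v \<in> carrier_vec (ns q)"
    and pq: "p \<in> {1..l}" "q \<in> {1..l}" "p \<noteq> q"
  shows "srk_weight h l ns (block_embed l ns p u + block_embed l ns q v) = rk_weight h u + rk_weight h v"
proof -
  note car = block_embed_carrier[where ns = ns and i = p and l = l, OF u] block_embed_carrier[where ns = ns and i = q and l = l, OF v]
  have "rk_weight h (vec_block ns k (block_embed l ns p u + block_embed l ns q v)) =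
      (if k = p then rk_weight h u else 0) + (if k = q then rk_weight h v else 0)" if k: "k \<in> {1..l}" for k
    unfolding vec_block_add[OF car k] vec_block_embed[where ns = ns and i = p, OF u k] vec_block_embed[where ns = ns and i = q, OF v k]
    using u v pq(3) by auto
  then have "srk_weight h l ns (block_embed l ns p u + block_embed l ns q v) =
      (\<Sum>k=1..l. (if k = p then rk_weight h u else 0) + (if k = q then rk_weight h v else 0))"
    unfolding srk_weight_def by (intro sum.cong refl) blast
  then show ?thesis
    using pq by (simp add: sum.distrib)
qed

text \<open>If the sum is \<open>c z\<close> with \<open>z\<close> over the small field, comparing coordinates shows that either
  \<^term>\<open>a\<close> and \<^term>\<open>b\<close> are proportional over that field, or \<^term>\<open>w\<close> and \<^term>\<open>w'\<close> are both multiples of \<open>z\<close>.\<close>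

lemma rk_weight_add_eq_1:
  assumes a: "a \<noteq> 0" and w: "w \<in> carrier_vec m" and w': "w' \<in> carrier_vec m" "w' \<noteq> 0\<^sub>v m"
    and rk: "rk_weight h (a \<cdot>\<^sub>v map_vec h w + b \<cdot>\<^sub>v map_vec h w') = 1"
  shows "(\<exists>t. b = h t * a) \<or> (\<exists>k<m. w' $ k \<noteq> 0 \<and> w' $ k \<cdot>\<^sub>v w = w $ k \<cdot>\<^sub>v w')"
proof (rule ccontr)
  assume contra: "\<not> ?thesis"
  have dim: "dim_vec (a \<cdot>\<^sub>v map_vec h w + b \<cdot>\<^sub>v map_vec h w') = m"
    using w' by simp
  obtain c z where c: "c \<noteq> 0" and z: "z \<in> carrier_vec m" "z \<noteq> 0\<^sub>v m"
    and eq: "a \<cdot>\<^sub>v map_vec h w + b \<cdot>\<^sub>v map_vec h w' = c \<cdot>\<^sub>v map_vec h z"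
    using rk_weight_eq_1E[OF rk] unfolding dim by metis
  obtain k where k: "k < m" "z $ k \<noteq> 0"
    using z by (auto simp: vec_eq_iff)
  have entry: "a * h (w $ r) + b * h (w' $ r) = c * h (z $ r)" if "r < m" for r
    using arg_cong[OF eq, of "\<lambda>v. v $ r"] that w w' z by simp
  \<comment> \<open>The unknown scalar c is eliminated by cross-multiplying the equations for the
    entries r and k.\<close>
  have comb: "a * h (z $ k * w $ r - z $ r * w $ k) = b * h (z $ r * w' $ k - z $ k * w' $ r)" if "r < m" for r
  proof -
    have "h (z $ k) * (a * h (w $ r) + b * h (w' $ r)) = h (z $ r) * (a * h (w $ k) + b * h (w' $ k))"
      unfolding entry[OF that] entry[OF k(1)] by (simp add: algebra_simps)
    then show ?thesis
      by (simp add: hom_distribs algebra_simps)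
  qed
  \<comment> \<open>A nonzero difference could be divided by in \<open>comb\<close>, giving b as a
    multiple of a by an element of E. This is the first alternative, which is excluded here.\<close>
  have ratio': "z $ k * w' $ r = z $ r * w' $ k" if "r < m" for r
  proof (rule ccontr)
    assume "z $ k * w' $ r \<noteq> z $ r * w' $ k"
    then have "h (z $ r * w' $ k - z $ k * w' $ r) \<noteq> 0"
      by simp
    then have "b = a * h (z $ k * w $ r - z $ r * w $ k) / h (z $ r * w' $ k - z $ k * w' $ r)"
      by (simp add: comb[OF that])
    also have "\<dots> = h ((z $ k * w $ r - z $ r * w $ k) / (z $ r * w' $ k - z $ k * w' $ r)) * a"
      by (simp add: divide_inverse hom_mult hom_inverse)
    finally show False
      using contra by blast
  qed
  \<comment> \<open>The right side of \<open>comb\<close> now vanishes, and a is nonzero while h is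
    injective.\<close>
  have ratio: "z $ k * w $ r = z $ r * w $ k" if "r < m" for r
    using comb[OF that] ratio'[OF that] a by simp
  obtain r where r: "r < m" "w' $ r \<noteq> 0"
    using w' by (auto simp: vec_eq_iff)
  \<comment> \<open>A position where z is nonzero also serves as the witness for w': if w' vanished
    there, \<open>ratio'\<close> would make it vanish everywhere.\<close>
  have "w' $ k \<noteq> 0"
    using ratio'[OF r(1)] k(2) r(2) by auto
  moreover have "w' $ k \<cdot>\<^sub>v w = w $ k \<cdot>\<^sub>v w'"
  proof (rule eq_vecI)
    fix s assume "s < dim_vec (w $ k \<cdot>\<^sub>v w')"
    then have s: "s < m"
      using w' by simp
    have "z $ k * (w' $ k * w $ s) = w' $ k * (z $ k * w $ s)"
      by (rule mult.left_commute)
    also have "\<dots> = w $ k * (z $ k * w' $ s)"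
      unfolding ratio[OF s] ratio'[OF s] by (simp only: mult.assoc mult.commute mult.left_commute)
    also have "\<dots> = z $ k * (w $ k * w' $ s)"
      by (rule mult.left_commute)
    finally show "(w' $ k \<cdot>\<^sub>v w) $ s = (w $ k \<cdot>\<^sub>v w') $ s"
      using k(2) s w w' by simp
  qed (use w w' in simp)
  ultimately show False
    using contra k(1) by blast
qed

section \<open>The block structure of a linear isometry\<close>

context
  fixes l ns N f
  assumes pos: "\<And>i. i \<in> {1..l} \<Longrightarrow> 0 < ns i"
    and N: "N = (\<Sum>i=1..l. ns i)"
    and lin: "vec_linear N f" and iso: "srk_isometry h l ns N f"
begin

lemma f_zero: "f (0\<^sub>v N) = 0\<^sub>v N"
proof -
  have zero: "0 \<cdot>\<^sub>v u = 0\<^sub>v N" if "u \<in> carrier_vec N" for u :: "'f vec"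
    using that by auto
  have "f (0 \<cdot>\<^sub>v 0\<^sub>v N) = 0 \<cdot>\<^sub>v f (0\<^sub>v N)"
    by (rule vec_linearD(3)[OF lin]) simp
  then show ?thesis
    using vec_linearD(1)[OF lin, of "0\<^sub>v N"] by (simp add: zero)
qed

lemma srk_weight_f:
  assumes "c \<in> carrier_vec N"
  shows "srk_weight h l ns (f c) = srk_weight h l ns c"
proof -
  have "srk_dist h l ns (f c) (f (0\<^sub>v N)) = srk_dist h l ns c (0\<^sub>v N)"
    using iso assms by (simp add: srk_isometry_def)
  then show ?thesis
    using assms vec_linearD(1)[OF lin assms] by (simp add: srk_dist_def f_zero)
qed

text \<open>This is injectivity, a consequence of weight preservation since zero is the only vector
  of weight 0.\<close>

lemma f_eq_0D:
  assumes "c \<in> carrier_vec N" "f c = 0\<^sub>v N"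
  shows "c = 0\<^sub>v N"
proof -
  have "srk_weight h l ns (f (0\<^sub>v N)) = srk_weight h l ns (0\<^sub>v N)"
    by (rule srk_weight_f) simp
  moreover have "srk_weight h l ns (0\<^sub>v N) = 0"
    unfolding srk_weight_def N
    by (intro sum.neutral ballI) (simp add: vec_block_zero del: One_nat_def)
  ultimately have "srk_weight h l ns c = 0"
    using srk_weight_f[OF assms(1)] assms(2) f_zero by simp
  then show ?thesis
    using assms(1) unfolding N by (rule srk_weight_eq_0D)
qed

lemma embed_carrier: "v \<in> carrier_vec (ns i) \<Longrightarrow> block_embed l ns i v \<in> carrier_vec N"
  unfolding N by (rule block_embed_carrier[where ns = ns and i = i])

lemma embed_eq_0_iff:
  assumes "v \<in> carrier_vec (ns i)" "i \<in> {1..l}"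
  shows "block_embed l ns i v = 0\<^sub>v N \<longleftrightarrow> v = 0\<^sub>v (ns i)"
proof
  assume "block_embed l ns i v = 0\<^sub>v N"
  then have "vec_block ns i (block_embed l ns i v) = vec_block ns i (0\<^sub>v N)"
    by simp
  then show "v = 0\<^sub>v (ns i)"
    unfolding N vec_block_zero[OF assms(2)] vec_block_embed[where ns = ns and i = i, OF assms] by simp
next
  assume v: "v = 0\<^sub>v (ns i)"
  have "block_embed l ns i (0 \<cdot>\<^sub>v v) = 0 \<cdot>\<^sub>v block_embed l ns i v"
    by (rule block_embed_smult[where ns = ns and i = i, OF assms(1)])
  moreover have "0 \<cdot>\<^sub>v v = v"
    unfolding v by auto
  moreover have "0 \<cdot>\<^sub>v block_embed l ns i v = 0\<^sub>v N"
    using embed_carrier[OF assms(1)] by auto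
  ultimately show "block_embed l ns i v = 0\<^sub>v N"
    by simp
qed

text \<open>A nonzero vector over E has rank weight 1, being 1 times itself, so the classification
  of weight 1 vectors applies to its image.\<close>

lemma f_embed_hom:
  assumes "i \<in> {1..l}" "v \<in> carrier_vec (ns i)" "v \<noteq> 0\<^sub>v (ns i)"
  obtains p b w where "p \<in> {1..l}" "b \<noteq> 0" "w \<in> carrier_vec (ns p)" "w \<noteq> 0\<^sub>v (ns p)"
    "f (block_embed l ns i (map_vec h v)) = block_embed l ns p (b \<cdot>\<^sub>v map_vec h w)"
proof -
  have v: "map_vec h v \<in> carrier_vec (ns i)"
    using assms(2) by simp
  have "srk_weight h l ns (f (block_embed l ns i (map_vec h v))) = rk_weight h (1 \<cdot>\<^sub>v map_vec h v)"
    using srk_weight_block_embed[where ns = ns and i = i, OF v assms(1)] srk_weight_f[OF embed_carrier[OF v]] by simp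
  also have "\<dots> = 1"
    by (rule rk_weight_smult_hom[OF _ assms(2,3)]) simp
  finally have "srk_weight h l ns (f (block_embed l ns i (map_vec h v))) = 1" .
  moreover have "f (block_embed l ns i (map_vec h v)) \<in> carrier_vec (\<Sum>i=1..l. ns i)"
    using vec_linearD(1)[OF lin embed_carrier[OF v]] unfolding N .
  ultimately show thesis
    by (rule srk_weight_eq_1E) (rule that)
qed

lemma map_vec_unit_vec: "map_vec h (unit_vec k j) = unit_vec k j"
  by (auto simp: unit_vec_def)

text \<open>The unit vector at index 0, which exists because blocks are nonempty, serves as
  reference: its image fixes p and a. Every other unit vector is compared with it through the weight
  of their sum.\<close>

lemma f_unit_vec:
  assumes i: "i \<in> {1..l}"
  obtains p a W where "p \<in> {1..l}" "a \<noteq> 0"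
    "\<And>j. j < ns i \<Longrightarrow> W j \<in> carrier_vec (ns p)"
    "\<And>j. j < ns i \<Longrightarrow> f (block_embed l ns i (unit_vec (ns i) j)) = block_embed l ns p (a \<cdot>\<^sub>v map_vec h (W j))"
proof -
  let ?e = "\<lambda>j. unit_vec (ns i) j"
  let ?E = "\<lambda>v. block_embed l ns i v"
  note ni = pos[OF i]
  obtain p a w where p: "p \<in> {1..l}" and a: "a \<noteq> 0" and w: "w \<in> carrier_vec (ns p)" "w \<noteq> 0\<^sub>v (ns p)"
    and f0: "f (?E (?e 0)) = block_embed l ns p (a \<cdot>\<^sub>v map_vec h w)"
    by (rule f_embed_hom[OF i, of "unit_vec (ns i) 0"]) (use ni in \<open>auto simp: map_vec_unit_vec vec_eq_iff\<close>)
  have "\<exists>w'. w' \<in> carrier_vec (ns p) \<and> f (?E (?e j)) = block_embed l ns p (a \<cdot>\<^sub>v map_vec h w')"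
    if j: "j < ns i" for j
  proof (cases "j = 0")
    case True
    then show ?thesis
      using w f0 by auto
  next
    case j0: False
    obtain q b w' where q: "q \<in> {1..l}" and b: "b \<noteq> 0" and w': "w' \<in> carrier_vec (ns q)" "w' \<noteq> 0\<^sub>v (ns q)"
      and fj: "f (?E (?e j)) = block_embed l ns q (b \<cdot>\<^sub>v map_vec h w')"
      by (rule f_embed_hom[OF i, of "unit_vec (ns i) j"]) (use j in \<open>auto simp: map_vec_unit_vec vec_eq_iff\<close>)
    have aw: "a \<cdot>\<^sub>v map_vec h w \<in> carrier_vec (ns p)" and bw: "b \<cdot>\<^sub>v map_vec h w' \<in> carrier_vec (ns q)"
      using w w' by simp_all
    define v :: "'e vec" where "v = unit_vec (ns i) 0 + unit_vec (ns i) j"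
    have hv: "map_vec h v = ?e 0 + ?e j" and v: "v \<in> carrier_vec (ns i)"
      by (auto simp: v_def unit_vec_def hom_distribs)
    have "v $ 0 \<noteq> 0"
      using j j0 ni by (simp add: v_def)
    then have "v \<noteq> 0\<^sub>v (ns i)"
      using ni by auto
    have E_add: "?E (x + y) = ?E x + ?E y" if "x \<in> carrier_vec (ns i)" "y \<in> carrier_vec (ns i)" for x y :: "'f vec"
      using that by (rule block_embed_add[where ns = ns and i = i])
    have f_add: "f (?E (x + y)) = f (?E x) + f (?E y)"
      if "x \<in> carrier_vec (ns i)" "y \<in> carrier_vec (ns i)" for x y
      unfolding E_add[OF that] using vec_linearD(2)[OF lin] embed_carrier that by blast
    have "srk_weight h l ns (f (?E (map_vec h v))) = rk_weight h (1 \<cdot>\<^sub>v map_vec h v)"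
      using srk_weight_f[OF embed_carrier, of "map_vec h v" i] v
        srk_weight_block_embed[where ns = ns and i = i and v = "map_vec h v", OF _ i] by simp
    also have "\<dots> = 1"
      by (rule rk_weight_smult_hom[OF _ v \<open>v \<noteq> _\<close>]) simp
    finally have wt: "srk_weight h l ns (block_embed l ns p (a \<cdot>\<^sub>v map_vec h w) +
        block_embed l ns q (b \<cdot>\<^sub>v map_vec h w')) = 1"
      unfolding hv by (simp add: f_add f0 fj)
    \<comment> \<open>In different blocks the two images would contribute weight 1 each, for a total
      of 2.\<close>
    have "q = p"
    proof (rule ccontr)
      assume "q \<noteq> p"
      then have "rk_weight h (a \<cdot>\<^sub>v map_vec h w) + rk_weight h (b \<cdot>\<^sub>v map_vec h w') = 1"
        using wt srk_weight_block_embed_add[where ns = ns and p = p and q = q, OF aw bw p q] by simp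
      then show False
        using rk_weight_smult_hom[OF a w] rk_weight_smult_hom[OF b w'] by simp
    qed
    note bw = bw[unfolded this] and w' = w'[unfolded this] and fj = fj[unfolded this]
    have "rk_weight h (a \<cdot>\<^sub>v map_vec h w + b \<cdot>\<^sub>v map_vec h w') = 1"
      using wt unfolding \<open>q = p\<close> block_embed_add[where ns = ns and i = p, OF aw bw, symmetric]
      using srk_weight_block_embed[where ns = ns and i = p, OF add_carrier_vec[OF aw bw] p] by simp
    then consider t where "b = h t * a"
      | k where "k < ns p" "w' $ k \<noteq> 0" "w' $ k \<cdot>\<^sub>v w = w $ k \<cdot>\<^sub>v w'"
      using rk_weight_add_eq_1[OF a w(1) w'] by blast
    then show ?thesis
    proof cases
      \<comment> \<open>The factor t lies in E and can be absorbed into w', so the image is written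
        with the reference scalar a.\<close>
      case 1
      then have "b \<cdot>\<^sub>v map_vec h w' = a \<cdot>\<^sub>v map_vec h (t \<cdot>\<^sub>v w')"
        by (auto simp: hom_distribs)
      then show ?thesis
        using fj w'(1) by (intro exI[of _ "t \<cdot>\<^sub>v w'"]) simp
    next
      case 2
      \<comment> \<open>The coefficients x and y are chosen in F so that
        \<open>x a w + y b w'\<close> becomes \<open>a b\<close> times the image under h of
        \<open>w'_k w - w_k w'\<close>, which is zero. Injectivity then forces x = 0, although b and
        \<open>w'_k\<close> are nonzero.\<close>
      define x where "x = b * h (w' $ k)"
      define y where "y = - (a * h (w $ k))"
      have car: "x \<cdot>\<^sub>v ?e 0 + y \<cdot>\<^sub>v ?e j \<in> carrier_vec (ns i)"
        by simp
      have "f (?E (x \<cdot>\<^sub>v ?e 0 + y \<cdot>\<^sub>v ?e j)) = x \<cdot>\<^sub>v f (?E (?e 0)) + y \<cdot>\<^sub>v f (?E (?e j))"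
        using vec_linearD(3)[OF lin embed_carrier[where i = i]]
        by (simp add: f_add block_embed_smult[where ns = ns and i = i])
      also have "\<dots> = block_embed l ns p (x \<cdot>\<^sub>v (a \<cdot>\<^sub>v map_vec h w) + y \<cdot>\<^sub>v (b \<cdot>\<^sub>v map_vec h w'))"
        unfolding f0 fj using aw bw
        by (simp add: block_embed_smult[where ns = ns and i = p] block_embed_add[where ns = ns and i = p])
      also have "x \<cdot>\<^sub>v (a \<cdot>\<^sub>v map_vec h w) + y \<cdot>\<^sub>v (b \<cdot>\<^sub>v map_vec h w') = 0\<^sub>v (ns p)"
      proof (rule eq_vecI)
        fix s assume "s < dim_vec (0\<^sub>v (ns p) :: 'f vec)"
        then have s: "s < ns p"
          by simp
        have "w' $ k * w $ s = w $ k * w' $ s"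
          using arg_cong[OF 2(3), of "\<lambda>v. v $ s"] s w w' by simp
        then have "h (w' $ k) * h (w $ s) = h (w $ k) * h (w' $ s)"
          by (metis hom_mult)
        then have "x * (a * h (w $ s)) + y * (b * h (w' $ s)) = 0"
          by (simp add: x_def y_def algebra_simps)
        then show "(x \<cdot>\<^sub>v (a \<cdot>\<^sub>v map_vec h w) + y \<cdot>\<^sub>v (b \<cdot>\<^sub>v map_vec h w')) $ s = 0\<^sub>v (ns p) $ s"
          using s w w' by simp
      qed (use w' in simp)
      also have "block_embed l ns p (0\<^sub>v (ns p) :: 'f vec) = 0\<^sub>v N"
        using embed_eq_0_iff[of "0\<^sub>v (ns p)" p] p by simp
      finally have "x \<cdot>\<^sub>v ?e 0 + y \<cdot>\<^sub>v ?e j = 0\<^sub>v (ns i)"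
        using f_eq_0D[OF embed_carrier[OF car]] embed_eq_0_iff[OF car i] by simp
      then have "(x \<cdot>\<^sub>v ?e 0 + y \<cdot>\<^sub>v ?e j) $ 0 = 0"
        using ni by simp
      then have "x = 0"
        using ni j j0 by simp
      then show ?thesis
        using b 2(2) by (simp add: x_def)
    qed
  qed
  then obtain W where "\<And>j. j < ns i \<Longrightarrow> W j \<in> carrier_vec (ns p)"
      "\<And>j. j < ns i \<Longrightarrow> f (?E (?e j)) = block_embed l ns p (a \<cdot>\<^sub>v map_vec h (W j))"
    by metis
  with p a show thesis
    by (rule that)
qed

lemma f_eq_srk_map:
  obtains a M \<pi> where "srk_params l ns a (M :: nat \<Rightarrow> 'e mat) \<pi>"
    "\<And>c. c \<in> carrier_vec N \<Longrightarrow> f c = srk_map h l ns a M \<pi> c"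
proof -
  let ?I = "{1..l}"
  have "\<forall>i\<in>?I. \<exists>p a W. p \<in> ?I \<and> a \<noteq> 0 \<and> (\<forall>j<ns i. W j \<in> carrier_vec (ns p) \<and>
      f (block_embed l ns i (unit_vec (ns i) j)) = block_embed l ns p (a \<cdot>\<^sub>v map_vec h (W j)))"
    by (metis f_unit_vec)
  then obtain p a W where p: "\<And>i. i \<in> ?I \<Longrightarrow> p i \<in> ?I" and a: "\<And>i. i \<in> ?I \<Longrightarrow> a i \<noteq> 0"
    and W: "\<And>i j. i \<in> ?I \<Longrightarrow> j < ns i \<Longrightarrow> W i j \<in> carrier_vec (ns (p i))"
    and f_unit: "\<And>i j. i \<in> ?I \<Longrightarrow> j < ns i \<Longrightarrow>
      f (block_embed l ns i (unit_vec (ns i) j)) = block_embed l ns (p i) (a i \<cdot>\<^sub>v map_vec h (W i j))"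
    unfolding bchoice_iff by blast
  \<comment> \<open>The images are stored as columns, so V acts on column vectors; it is transposed
    at the end to match the convention of row vectors.\<close>
  define V where "V i = mat (ns (p i)) (ns i) (\<lambda>(r, j). W i j $ r)" for i
  have V: "V i \<in> carrier_mat (ns (p i)) (ns i)" for i
    by (simp add: V_def)
  have col_V: "col (V i) j = W i j" if "i \<in> ?I" "j < ns i" for i j
    using W[OF that] that by (auto simp: V_def)
  \<comment> \<open>The matrix is read off from unit vectors, but the formula holds for all vectors
    over F because both sides are F-linear.\<close>
  have f_embed: "f (block_embed l ns i v) = block_embed l ns (p i) (a i \<cdot>\<^sub>v (map_mat h (V i) *\<^sub>v v))"
    if i: "i \<in> ?I" and v: "v \<in> carrier_vec (ns i)" for i v
  proof (rule linear_eq_on_unit_vecs[where n = "ns i" and m = N and c = v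
        and f = "\<lambda>v. f (block_embed l ns i v)"
        and g = "\<lambda>v. block_embed l ns (p i) (a i \<cdot>\<^sub>v (map_mat h (V i) *\<^sub>v v))"])
    have hV: "map_mat h (V i) \<in> carrier_mat (ns (p i)) (ns i)"
      using V by simp
    have img: "a i \<cdot>\<^sub>v (map_mat h (V i) *\<^sub>v u) \<in> carrier_vec (ns (p i))" for u
      by (rule carrier_vecI) (simp add: V_def)
    fix u v :: "'f vec" and b
    assume u: "u \<in> carrier_vec (ns i)"
    show "f (block_embed l ns i u) \<in> carrier_vec N"
      by (rule vec_linearD(1)[OF lin embed_carrier[OF u]])
    show "block_embed l ns (p i) (a i \<cdot>\<^sub>v (map_mat h (V i) *\<^sub>v u)) \<in> carrier_vec N"
      by (rule embed_carrier[OF img])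
    show "f (block_embed l ns i (b \<cdot>\<^sub>v u)) = b \<cdot>\<^sub>v f (block_embed l ns i u)"
      unfolding block_embed_smult[where ns = ns and i = i, OF u]
      by (rule vec_linearD(3)[OF lin embed_carrier[OF u]])
    have "a i \<cdot>\<^sub>v (map_mat h (V i) *\<^sub>v (b \<cdot>\<^sub>v u)) = b \<cdot>\<^sub>v (a i \<cdot>\<^sub>v (map_mat h (V i) *\<^sub>v u))"
      unfolding mult_mat_vec[OF hV u] by (simp add: smult_smult_assoc mult.commute)
    then show "block_embed l ns (p i) (a i \<cdot>\<^sub>v (map_mat h (V i) *\<^sub>v (b \<cdot>\<^sub>v u))) =
        b \<cdot>\<^sub>v block_embed l ns (p i) (a i \<cdot>\<^sub>v (map_mat h (V i) *\<^sub>v u))"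
      by (simp add: block_embed_smult[where ns = ns and i = "p i", OF img])
    assume v: "v \<in> carrier_vec (ns i)"
    show "f (block_embed l ns i (u + v)) = f (block_embed l ns i u) + f (block_embed l ns i v)"
      unfolding block_embed_add[where ns = ns and i = i, OF u v]
      by (rule vec_linearD(2)[OF lin embed_carrier[OF u] embed_carrier[OF v]])
    have "a i \<cdot>\<^sub>v (map_mat h (V i) *\<^sub>v (u + v)) =
        a i \<cdot>\<^sub>v (map_mat h (V i) *\<^sub>v u) + a i \<cdot>\<^sub>v (map_mat h (V i) *\<^sub>v v)"
      unfolding mult_add_distrib_mat_vec[OF hV u v]
      by (rule smult_add_distrib_vec[where n = "ns (p i)"]) (use mult_mat_vec_carrier[OF hV] u v in auto)
    then show "block_embed l ns (p i) (a i \<cdot>\<^sub>v (map_mat h (V i) *\<^sub>v (u + v))) =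
        block_embed l ns (p i) (a i \<cdot>\<^sub>v (map_mat h (V i) *\<^sub>v u)) +
        block_embed l ns (p i) (a i \<cdot>\<^sub>v (map_mat h (V i) *\<^sub>v v))"
      by (simp add: block_embed_add[where ns = ns and i = "p i", OF img img])
  next
    fix j assume j: "j < ns i"
    have "map_mat h (V i) *\<^sub>v unit_vec (ns i) j = map_vec h (col (V i) j)"
      using V[of i] j by (intro eq_vecI) auto
    then show "f (block_embed l ns i (unit_vec (ns i) j)) =
        block_embed l ns (p i) (a i \<cdot>\<^sub>v (map_mat h (V i) *\<^sub>v unit_vec (ns i) j))"
      by (simp only: f_unit[OF i j] col_V[OF i j])
  qed (rule v)

  \<comment> \<open>Injectivity of V is needed over E, where the determinant lives. A kernel vector
    over E maps under h to a kernel vector over F, which f would send to 0.\<close>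
  have V_inj: "v = 0\<^sub>v (ns i)" if i: "i \<in> ?I" and v: "v \<in> carrier_vec (ns i)" and "V i *\<^sub>v v = 0\<^sub>v (ns (p i))" for i v
  proof -
    have hv: "map_vec h v \<in> carrier_vec (ns i)"
      using v by simp
    have "map_mat h (V i) *\<^sub>v map_vec h v = map_vec h (V i *\<^sub>v v)"
      using mult_mat_vec_hom[OF V v] by simp
    then have "a i \<cdot>\<^sub>v (map_mat h (V i) *\<^sub>v map_vec h v) = 0\<^sub>v (ns (p i))"
      using that(3) by auto
    then have "f (block_embed l ns i (map_vec h v)) = 0\<^sub>v N"
      using f_embed[OF i hv] embed_eq_0_iff[of "0\<^sub>v (ns (p i))" "p i"] p[OF i] by simp
    then have "map_vec h v = 0\<^sub>v (ns i)"
      using f_eq_0D[OF embed_carrier[OF hv]] embed_eq_0_iff[OF hv i] by simp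
    then show ?thesis
      using v by (auto simp: vec_eq_iff)
  qed

  text \<open>Padding with zero rows gives a square matrix, whose determinant vanishes if a row was added.\<close>
  define A where "A i = mat (ns i) (ns i) (\<lambda>(r, j). if r < ns (p i) then W i j $ r else 0)" for i
  have A: "A i \<in> carrier_mat (ns i) (ns i)" for i
    by (simp add: A_def)
  \<comment> \<open>As long as the target block is no longer than block i, A contains all rows of V,
    so a kernel vector of A is one of V.\<close>
  have det_A: "det (A i) \<noteq> 0" if i: "i \<in> ?I" and le: "ns (p i) \<le> ns i" for i
  proof
    assume "det (A i) = 0"
    then obtain v where v: "v \<in> carrier_vec (ns i)" "v \<noteq> 0\<^sub>v (ns i)" "A i *\<^sub>v v = 0\<^sub>v (ns i)"
      using det_0_iff_vec_prod_zero_field[OF A] by blast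
    have "(V i *\<^sub>v v) $ r = 0" if "r < ns (p i)" for r
    proof -
      have "row (V i) r = row (A i) r"
        using that le by (intro eq_vecI) (simp_all add: V_def A_def)
      then have "(V i *\<^sub>v v) $ r = (A i *\<^sub>v v) $ r"
        using that le V[of i] A[of i] by simp
      then show ?thesis
        using that le v(3) by simp
    qed
    then have "V i *\<^sub>v v = 0\<^sub>v (ns (p i))"
      using V[of i] by (intro eq_vecI) auto
    then show False
      using V_inj[OF i v(1)] v(2) by simp
  qed
  have ns_le: "ns i \<le> ns (p i)" if i: "i \<in> ?I" for i
  proof (rule ccontr)
    assume "\<not> ns i \<le> ns (p i)"
    then have lt: "ns (p i) < ns i"
      by simp
    \<comment> \<open>Rows are counted from 0, so \<open>ns (p i)\<close> is the index of the first
      padded row. The transpose therefore annihilates the unit vector at this index.\<close>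
    have "transpose_mat (A i) *\<^sub>v unit_vec (ns i) (ns (p i)) = 0\<^sub>v (ns i)"
      using lt by (intro eq_vecI) (simp_all add: A_def)
    moreover have "unit_vec (ns i) (ns (p i)) \<noteq> (0\<^sub>v (ns i) :: 'e vec)"
      using lt by (auto simp: vec_eq_iff)
    ultimately have "det (transpose_mat (A i)) = 0"
      unfolding det_0_iff_vec_prod_zero_field[OF iffD2[OF transpose_carrier_mat A]]
      using unit_vec_carrier by blast
    then show False
      using det_A[OF i] lt det_transpose[OF A[of i]] by simp
  qed

  have "inj_on p ?I"
  proof (rule inj_onI, rule ccontr)
    fix i k assume i: "i \<in> ?I" and k: "k \<in> ?I" and eq: "p i = p k" and "i \<noteq> k"
    define u where "u = (1 / a i) \<cdot>\<^sub>v unit_vec (ns i) 0"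
    define v where "v = (1 / a k) \<cdot>\<^sub>v unit_vec (ns k) 0"
    have uv: "u \<in> carrier_vec (ns i)" "v \<in> carrier_vec (ns k)"
      by (simp_all add: u_def v_def)
    have f_scaled: "f (block_embed l ns i ((1 / a i) \<cdot>\<^sub>v unit_vec (ns i) 0)) = block_embed l ns (p i) (map_vec h (W i 0))"
      if i: "i \<in> ?I" for i
    proof -
      have W0: "map_vec h (W i 0) \<in> carrier_vec (ns (p i))"
        using W[OF i pos[OF i]] by simp
      have unit: "unit_vec (ns i) 0 \<in> carrier_vec (ns i)"
        by simp
      have "f (block_embed l ns i ((1 / a i) \<cdot>\<^sub>v unit_vec (ns i) 0)) =
          (1 / a i) \<cdot>\<^sub>v f (block_embed l ns i (unit_vec (ns i) 0))"
        unfolding block_embed_smult[where ns = ns and i = i, OF unit]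
        by (rule vec_linearD(3)[OF lin embed_carrier[OF unit]])
      also have "\<dots> = (1 / a i) \<cdot>\<^sub>v (a i \<cdot>\<^sub>v block_embed l ns (p i) (map_vec h (W i 0)))"
        by (simp add: f_unit[OF i pos[OF i]] block_embed_smult[where ns = ns and i = "p i", OF W0])
      finally show ?thesis
        using a[OF i] by (simp add: smult_smult_assoc)
    qed
    have neq: "u \<noteq> 0\<^sub>v (ns i)" "v \<noteq> 0\<^sub>v (ns k)"
      using a[OF i] a[OF k] pos[OF i] pos[OF k] by (auto simp: u_def v_def vec_eq_iff)
    then have "2 \<le> rk_weight h u + rk_weight h v"
      using rk_weight_eq_0_iff[OF uv(1)] rk_weight_eq_0_iff[OF uv(2)] by linarith
    also have "\<dots> = srk_weight h l ns (block_embed l ns i u + block_embed l ns k v)"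
      using srk_weight_block_embed_add[where ns = ns and p = i and q = k, OF uv i k \<open>i \<noteq> k\<close>] by simp
    also have "\<dots> = srk_weight h l ns (f (block_embed l ns i u + block_embed l ns k v))"
      using srk_weight_f[of "block_embed l ns i u + block_embed l ns k v"] embed_carrier[OF uv(1)] embed_carrier[OF uv(2)]
      by simp
    also have "f (block_embed l ns i u + block_embed l ns k v) = f (block_embed l ns i u) + f (block_embed l ns k v)"
      by (rule vec_linearD(2)[OF lin embed_carrier[OF uv(1)] embed_carrier[OF uv(2)]])
    also have "\<dots> = block_embed l ns (p i) (map_vec h (W i 0)) + block_embed l ns (p i) (map_vec h (W k 0))"
      unfolding u_def v_def f_scaled[OF i] f_scaled[OF k] eq ..
    also have "\<dots> = block_embed l ns (p i) (map_vec h (W i 0) + map_vec h (W k 0))"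
      using W[OF i pos[OF i]] W[OF k pos[OF k]] eq
      by (intro block_embed_add[where ns = ns and i = "p i", symmetric]) simp_all
    also have "map_vec h (W i 0) + map_vec h (W k 0) = 1 \<cdot>\<^sub>v map_vec h (W i 0 + W k 0)"
      using W[OF i pos[OF i]] W[OF k pos[OF k]] eq by (intro eq_vecI) (auto simp: hom_add)
    also have "srk_weight h l ns (block_embed l ns (p i) (1 \<cdot>\<^sub>v map_vec h (W i 0 + W k 0))) =
        rk_weight h (1 \<cdot>\<^sub>v map_vec h (W i 0 + W k 0))"
      using W[OF i pos[OF i]] W[OF k pos[OF k]] eq
      by (intro srk_weight_block_embed[where ns = ns and i = "p i"] p i) simp
    \<comment> \<open>Just an upper bound is available, since the two vectors over E might
      cancel.\<close>
    also have "\<dots> \<le> 1"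
      by (rule rk_weight_smult_hom_le)
    finally show False
      by simp
  qed
  moreover have "p ` ?I \<subseteq> ?I"
    using p by blast
  ultimately have bij: "bij_betw p ?I ?I"
    by (simp add: bij_betw_def endo_inj_surj)
  have ns_eq: "ns (p i) = ns i" if "i \<in> ?I" for i
    using sum_mono_inv[of ns ?I "\<lambda>i. ns (p i)" i] sum.reindex_bij_betw[OF bij, of ns] ns_le that by simp

  \<comment> \<open>The symmetric group consists of permutations of all natural numbers that fix
    everything outside \<open>{1..l}\<close>, so p is extended by the identity.\<close>
  define \<pi> where "\<pi> i = (if i \<in> ?I then p i else i)" for i
  have \<pi>_permutes: "\<pi> permutes ?I"
  proof (rule bij_imp_permutes)
    show "bij_betw \<pi> ?I ?I"
      using bij by (rule bij_betw_cong[THEN iffD1, rotated]) (simp add: \<pi>_def)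
  qed (simp add: \<pi>_def del: atLeastAtMost_iff)
  then have perm: "\<pi> \<in> carrier (part_perms l ns)"
    by (simp add: part_perms_def sym_group_carrier \<pi>_def ns_eq del: atLeastAtMost_iff)
  note perm_facts = part_permsD[OF perm]
  \<comment> \<open>The data found above are indexed by the source block, whereas
    \<open>srk_map\<close> expects them at the target block; hence the inverse of \<pi>.\<close>
  define a' where "a' k = a (inv_into UNIV \<pi> k)" for k
  define M where "M k = transpose_mat (V (inv_into UNIV \<pi> k))" for k
  have V_unit: "transpose_mat (V i) \<in> carrier (GL TYPE('e) (ns i))" if i: "i \<in> ?I" for i
  proof -
    \<comment> \<open>With equal lengths there is no padding, so the determinant already computed is
      that of V.\<close>
    have "V i = A i"
      by (intro eq_matI) (simp_all add: V_def A_def ns_eq[OF i])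
    then have "det (transpose_mat (V i)) \<noteq> 0"
      using det_A[OF i] ns_eq[OF i] det_transpose[OF A[of i]] by simp
    then show ?thesis
      unfolding units_of_carrier using V[of i] ns_eq[OF i] by (intro det_non_zero_imp_unit) simp_all
  qed
  have params: "srk_params l ns a' M \<pi>"
    unfolding srk_params_def a'_def M_def
    using a[OF perm_facts(3)] V_unit[OF perm_facts(3)] perm_facts(5) perm by simp
  have "f c = srk_map h l ns a' M \<pi> c" if "c \<in> carrier_vec N" for c
  proof (rule linear_eq_on_unit_vecs[OF vec_linearD[OF lin] vec_linearD[OF vec_linear_srk_map[OF params, folded N]] _ that])
    fix k assume "k < N"
    then obtain i j where i: "i \<in> ?I" and j: "j < ns i" and k: "k = (\<Sum>m\<in>{1..<i}. ns m) + j"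
      unfolding N using index_in_block by blast
    have unit: "unit_vec (ns i) j \<in> carrier_vec (ns i)"
      by simp
    have inv: "inv_into UNIV \<pi> (p i) = i" and pi: "\<pi> i = p i"
      using perm_facts(7)[of i] i by (simp_all add: \<pi>_def)
    have "row_mult (unit_vec (ns i) j) (map_mat h (transpose_mat (V i))) = row (map_mat h (transpose_mat (V i))) j"
      by (rule row_mult_unit_vec[OF _ j]) (use V[of i] in simp)
    also have "\<dots> = map_vec h (col (V i) j)"
      using V[of i] j by (intro eq_vecI) simp_all
    also have "\<dots> = map_vec h (W i j)"
      by (simp only: col_V[OF i j])
    finally have row: "row_mult (unit_vec (ns i) j) (map_mat h (transpose_mat (V i))) = map_vec h (W i j)" .
    have "srk_map h l ns a' M \<pi> (block_embed l ns i (unit_vec (ns i) j)) =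
        block_embed l ns (p i) (a i \<cdot>\<^sub>v map_vec h (W i j))"
      unfolding srk_map_block_embed[where ns = ns and i = i, OF params unit i] pi a'_def M_def inv row ..
    moreover have "(unit_vec N k :: 'f vec) = block_embed l ns i (unit_vec (ns i) j)"
      unfolding N k by (rule unit_vec_eq_block_embed[where ns = ns and i = i, OF i j])
    ultimately show "f (unit_vec N k) = srk_map h l ns a' M \<pi> (unit_vec N k)"
      by (simp only: f_unit[OF i j])
  qed
  with params show thesis
    by (rule that)
qed

end

section \<open>Isometries as the image of the action\<close>

lemma srk_isometry_iff:
  assumes pos: "\<forall>i\<in>{1..l}. 0 < ns i" and n: "n = (\<Sum>i=1..l. ns i)" and lin: "vec_linear n f"
  shows "srk_isometry h l ns n f \<longleftrightarrow>
    (\<exists>a (M :: nat \<Rightarrow> 'e mat) \<pi>. srk_params l ns a M \<pi> \<and> (\<forall>c\<in>carrier_vec n. f c = srk_map h l ns a M \<pi> c))"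
    (is "_ \<longleftrightarrow> ?rhs")
proof
  assume iso: "srk_isometry h l ns n f"
  show ?rhs
  proof (rule f_eq_srk_map[OF _ n lin iso])
    show "0 < ns i" if "i \<in> {1..l}" for i
      using pos that by blast
  qed blast
next
  assume ?rhs
  then obtain a and M :: "nat \<Rightarrow> 'e mat" and \<pi> where params: "srk_params l ns a M \<pi>"
    and f: "\<And>c. c \<in> carrier_vec n \<Longrightarrow> f c = srk_map h l ns a M \<pi> c"
    by blast
  show "srk_isometry h l ns n f"
    unfolding srk_isometry_def srk_dist_def
  proof (intro ballI)
    fix u v :: "'f vec" assume uv: "u \<in> carrier_vec n" "v \<in> carrier_vec n"
    have "f u - f v = srk_map h l ns a M \<pi> (u - v)"
      using vec_linear_minus[OF lin uv] f[of "u - v"] uv by simp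
    then show "srk_weight h l ns (f u - f v) = srk_weight h l ns (u - v)"
      by (simp add: srk_weight_srk_map[OF params])
  qed
qed

lemma srk_action_image:
  assumes pos: "\<forall>i\<in>{1..l}. 0 < ns i" and n: "n = (\<Sum>i=1..l. ns i)"
  shows "srk_action h l ns n ` carrier (srk_group TYPE('e) TYPE('f) l ns) = linear_isometries h l ns n"
    (is "?act ` carrier ?G = _")
proof (intro equalityI subsetI)
  fix f assume "f \<in> ?act ` carrier ?G"
  then obtain a M \<pi> where g: "((a, M), \<pi>) \<in> carrier ?G" and f: "f = ?act ((a, M), \<pi>)"
    by (metis (no_types, lifting) imageE prod.exhaust)
  from g have params: "srk_params l ns a M \<pi>"
    by (simp add: carrier_srk_group_iff)
  interpret group_action ?G "carrier_vec n" ?act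
    by (rule group_action_srk_action[OF n])
  \<comment> \<open>Bijectivity is inherited from the action, which takes values in the group of
    bijections.\<close>
  have "f \<in> Bij (carrier_vec n)"
    using group_hom.hom_closed[OF group_hom g] by (simp add: f BijGroup_def)
  moreover have f_eq: "f c = srk_map h l ns a M \<pi> c" if "c \<in> carrier_vec n" for c
    using that by (simp add: f srk_action_def)
  have lin: "vec_linear n f"
  proof (rule vec_linearI)
    note map = vec_linearD[OF vec_linear_srk_map[OF params, folded n]]
    fix u v :: "'f vec" and b
    assume u: "u \<in> carrier_vec n"
    show "f u \<in> carrier_vec n"
      using map(1)[OF u] f_eq[OF u] by simp
    show "f (b \<cdot>\<^sub>v u) = b \<cdot>\<^sub>v f u"
      using map(3)[OF u] u by (simp add: f_eq)
    assume v: "v \<in> carrier_vec n"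
    show "f (u + v) = f u + f v"
      using map(2)[OF u v] u v by (simp add: f_eq)
  qed
  moreover have "srk_isometry h l ns n f"
    unfolding srk_isometry_iff[OF pos n lin] using params f_eq by blast
  ultimately show "f \<in> linear_isometries h l ns n"
    by (simp add: linear_isometries_def)
next
  fix f assume "f \<in> linear_isometries h l ns n"
  then have "f \<in> extensional (carrier_vec n)" and lin: "vec_linear n f" and iso: "srk_isometry h l ns n f"
    by (auto simp: linear_isometries_def Bij_def)
  from iso obtain a and M :: "nat \<Rightarrow> 'e mat" and \<pi> where params: "srk_params l ns a M \<pi>"
    and f: "\<And>c. c \<in> carrier_vec n \<Longrightarrow> f c = srk_map h l ns a M \<pi> c"
    unfolding srk_isometry_iff[OF pos n lin] by blast
  \<comment> \<open>Restricting the parameters yields a group element. Elements of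
    \<open>Bij\<close> are extensional, so agreement with f on the vectors of length n is equality
    of functions.\<close>
  let ?g = "((restrict a {1..l}, restrict M {1..l}), \<pi>)"
  have "?g \<in> carrier ?G"
    using params by (simp add: carrier_srk_group_iff srk_params_def)
  moreover have "?act ?g = f"
  proof (rule extensionalityI)
    fix c :: "'f vec" assume c: "c \<in> carrier_vec n"
    have "srk_map h l ns (restrict a {1..l}) (restrict M {1..l}) \<pi> c = srk_map h l ns a M \<pi> c"
      by (rule srk_map_cong) simp_all
    then show "?act ?g c = f c"
      using c f[OF c] by (simp add: srk_action_def)
  qed (use \<open>f \<in> extensional _\<close> in \<open>simp_all add: srk_action_def\<close>)
  ultimately show "f \<in> ?act ` carrier ?G"
    by (metis image_eqI)
qed

end

theorem theorem3p7:
  fixes h :: "'e::field \<Rightarrow> 'f::field" and n l :: nat and ns :: "nat \<Rightarrow> nat"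
  assumes "finite_extension h"
    and "0 < n"
    and "\<forall>i\<in>{1..l}. 0 < ns i"
    and "n = (\<Sum>i=1..l. ns i)"
  shows "group_action (srk_group TYPE('e) TYPE('f) l ns) (carrier_vec n) (srk_action h l ns n) \<and>
    subgroup (linear_isometries h l ns n) (BijGroup (carrier_vec n)) \<and>
    srk_action h l ns n ` carrier (srk_group TYPE('e) TYPE('f) l ns) = linear_isometries h l ns n \<and>
    (\<forall>f :: 'f vec \<Rightarrow> 'f vec. vec_linear n f \<longrightarrow>
      (srk_isometry h l ns n f \<longleftrightarrow>
        (\<exists>a M \<pi>. (\<forall>i\<in>{1..l}. a i \<noteq> 0) \<and>
          (\<forall>i\<in>{1..l}. M i \<in> carrier (GL TYPE('e) (ns i))) \<and>
          \<pi> \<in> carrier (part_perms l ns) \<and>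
          (\<forall>c\<in>carrier_vec n. f c = srk_map h l ns a M \<pi> c))))"
proof -
  obtain B where "field_hom h" "finite_dimensional_vector_space (ext_scale h) B"
    using assms(1) by (auto simp: finite_extension_def)
  then interpret finite_degree_ext h B
    by (simp add: finite_degree_ext_def finite_degree_ext_axioms_def)
  interpret action: group_action "srk_group TYPE('e) TYPE('f) l ns" "carrier_vec n" "srk_action h l ns n"
    by (rule group_action_srk_action[OF assms(4)])
  have image: "srk_action h l ns n ` carrier (srk_group TYPE('e) TYPE('f) l ns) = linear_isometries h l ns n"
    by (rule srk_action_image[OF assms(3,4)])
  \<comment> \<open>Closure under composition and inverses follows because the isometries are the
    image of a group homomorphism.\<close>
  have "subgroup (linear_isometries h l ns n) (BijGroup (carrier_vec n))"
    using group_hom.img_is_subgroup[OF action.group_hom] by (simp only: image)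
  then show ?thesis
    using action.group_action_axioms image srk_isometry_iff[OF assms(3,4)]
    unfolding srk_params_def conj_assoc by blast
qed

end
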